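(* The Maximum Total Transitivity Problem can be solved in polynomial time for trees: given a tree $T$ (with at least two vertices), a total transitive partition of $T$ of maximum order, and in particular $Tr_t(T)$, can be computed in time polynomial in the number of vertices of $T$.
   Context: A total transitive partition of order $k$ of a graph $G=(V,E)$ without isolated vertices is a partition $\{V_1,\dots,V_k\}$ of $V$ into nonempty sets such that for all $1\leq i\leq j\leq k$, every vertex of $V_j$ has a neighbour in $V_i$ (for $i=j$: every vertex of $V_i$ is adjacent to another vertex of $V_i$). $Tr_t(G)$ is the maximum order of such a partition. The Maximum Total Transitivity Problem asks, for an input graph, for a total transitive partition of maximum order. *)

theory Defs
  imports
    "Graph_Theory.Digraph_Component"
    "HOL-Library.Disjoint_Sets"
    "HOL-Computational_Algebra.Polynomial"
begin

section \<open>Trees\<close>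

text \<open>
  A finite simple graph is a \<^locale>\<open>pair_graph\<close>, i.e. an edge \<open>uv\<close> is the pair of arcs
  \<open>(u,v)\<close>, \<open>(v,u)\<close>. The library's \<^const>\<open>tree\<close> forbids all directed cycles, including the
  closed walk \<open>u, v, u\<close> along a single edge, so no symmetric graph with an edge satisfies it.
  The cycles of an undirected simple graph are the directed cycles of length at least 3.
\<close>

definition undirected_tree :: "'a pair_pre_digraph \<Rightarrow> bool" where
  "undirected_tree G \<longleftrightarrow>
     pair_graph G \<and> Digraph_Component.connected (with_proj G) \<and>
     \<not> (\<exists>p. pre_digraph.cycle (with_proj G) p \<and> 3 \<le> length p)"

section \<open>Total transitivity\<close>

text \<open>The classes are \<open>V 1, \<dots>, V k\<close>; other values of \<open>V\<close> are irrelevant.\<close>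

definition total_transitive_partition ::
    "'a pair_pre_digraph \<Rightarrow> nat \<Rightarrow> (nat \<Rightarrow> 'a set) \<Rightarrow> bool" where
  "total_transitive_partition G k V \<longleftrightarrow>
     partition_on (pverts G) (V ` {1..k}) \<and> inj_on V {1..k} \<and>
     (\<forall>i j. 1 \<le> i \<and> i \<le> j \<and> j \<le> k \<longrightarrow> (\<forall>v\<in>V j. \<exists>u\<in>V i. (v, u) \<in> parcs G))"

definition Tr_t :: "'a pair_pre_digraph \<Rightarrow> nat" where
  "Tr_t G = Max {k. \<exists>V. total_transitive_partition G k V}"

section \<open>Model of computation\<close>

text \<open>
  A random access machine, programmed in a structured way: a program works on finitely many
  unbounded arrays of natural numbers, where \<open>Cell x e\<close> is the entry of array \<open>x\<close> at the computed
  index \<open>e\<close> (a scalar variable is an array used at index 0 only).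

  Every assignment and every test costs one step. Expressions have a size fixed by the program, so
  this is the number of elementary operations up to a constant factor. As there is no
  multiplication, numbers have at most linearly many bits in the running time plus the input
  length, hence unit cost is polynomially equivalent to logarithmic cost and to Turing machine time.
\<close>

datatype aexp =
    N nat
  | Cell nat aexp
  | Plus aexp aexp
  | Minus aexp aexp

datatype com =
    Skip
  | Assign nat aexp aexp
  | Seq com com
  | If aexp com com
  | While aexp com

type_synonym state = "nat \<Rightarrow> nat \<Rightarrow> nat"

fun aval :: "aexp \<Rightarrow> state \<Rightarrow> nat" where
  "aval (N n) s = n"
| "aval (Cell x e) s = s x (aval e s)"
| "aval (Plus a b) s = aval a s + aval b s"
| "aval (Minus a b) s = aval a s - aval b s"

text \<open>\<open>exec c s t s'\<close>: started in \<open>s\<close>, the program \<open>c\<close> halts after \<open>t\<close> steps in \<open>s'\<close>. A test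
  succeeds iff its value is nonzero.\<close>

inductive exec :: "com \<Rightarrow> state \<Rightarrow> nat \<Rightarrow> state \<Rightarrow> bool" where
  Skip: "exec Skip s 1 s"
| Assign: "exec (Assign x i e) s 1 (s(x := (s x)(aval i s := aval e s)))"
| Seq: "exec c1 s t1 s' \<Longrightarrow> exec c2 s' t2 s'' \<Longrightarrow> exec (Seq c1 c2) s (t1 + t2) s''"
| IfTrue: "aval e s \<noteq> 0 \<Longrightarrow> exec c1 s t s' \<Longrightarrow> exec (If e c1 c2) s (1 + t) s'"
| IfFalse: "aval e s = 0 \<Longrightarrow> exec c2 s t s' \<Longrightarrow> exec (If e c1 c2) s (1 + t) s'"
| WhileFalse: "aval e s = 0 \<Longrightarrow> exec (While e c) s 1 s"
| WhileTrue: "aval e s \<noteq> 0 \<Longrightarrow> exec c s t1 s' \<Longrightarrow> exec (While e c) s' t2 s'' \<Longrightarrow>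
    exec (While e c) s (1 + t1 + t2) s''"

inductive_cases exec_elims:
  "exec Skip s t s'"
  "exec (Assign x i e) s t s'"
  "exec (Seq c1 c2) s t s'"
  "exec (If e c1 c2) s t s'"
  "exec (While e c) s t s'"

lemma exec_deterministic:
  "exec c s t s' \<Longrightarrow> exec c s u s'' \<Longrightarrow> u = t \<and> s'' = s'"
proof (induction arbitrary: u s'' rule: exec.induct)
  case (Skip s)
  then show ?case by (rule exec_elims(1)) simp
next
  case (Assign x i e s)
  then show ?case by (rule exec_elims(2)) simp
next
  case (Seq c1 s t1 s' c2 t2 s2)
  show ?case
  proof (rule exec_elims(3)[OF Seq.prems])
    fix u1 r u2
    assume u: "u = u1 + u2" and 1: "exec c1 s u1 r" and 2: "exec c2 r u2 s''"
    from Seq.IH(1)[OF 1] have r: "u1 = t1" "r = s'" by auto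
    from Seq.IH(2)[OF 2[unfolded r(2)]] show ?thesis using u r by simp
  qed
next
  case (IfTrue e s c1 t s' c2)
  show ?case
  proof (rule exec_elims(4)[OF IfTrue.prems])
    fix r assume "u = Suc r" "exec c1 s r s''"
    then show ?thesis using IfTrue.IH[of r s''] by simp
  qed (use IfTrue.hyps in simp)
next
  case (IfFalse e s c2 t s' c1)
  show ?case
  proof (rule exec_elims(4)[OF IfFalse.prems])
    fix r assume "u = Suc r" "exec c2 s r s''"
    then show ?thesis using IfFalse.IH[of r s''] by simp
  qed (use IfFalse.hyps in simp)
next
  case (WhileFalse e s c)
  show ?case
    by (rule exec_elims(5)[OF WhileFalse.prems]) (simp, use WhileFalse.hyps in simp)
next
  case (WhileTrue e s c t1 s' t2 s2)
  show ?case
  proof (rule exec_elims(5)[OF WhileTrue.prems])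
    assume "aval e s = 0"
    with WhileTrue.hyps(1) show ?thesis by simp
  next
    fix u1 r u2
    assume u: "u = Suc (u1 + u2)" and 1: "exec c s u1 r" and 2: "exec (While e c) r u2 s''"
    from WhileTrue.IH(1)[OF 1] have r: "u1 = t1" "r = s'" by auto
    from WhileTrue.IH(2)[OF 2[unfolded r(2)]] show ?thesis using u r by simp
  qed
qed

section \<open>Input and output\<close>

text \<open>
  A graph on the vertices \<open>0, \<dots>, n - 1\<close> is given by \<open>n\<close> in array 0 and its adjacency matrix, row by
  row, in array 1. All other cells are initially 0.
\<close>

definition input_state :: "nat pair_pre_digraph \<Rightarrow> state" where
  "input_state G x i =
     (let n = card (pverts G) in
      if x = 0 \<and> i = 0 then n
      else if x = 1 \<and> i < n * n \<and> (i div n, i mod n) \<in> parcs G then 1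
      else 0)"

text \<open>The order of the computed partition is in array 2, the class number of vertex \<open>v\<close> is entry
  \<open>v\<close> of array 3.\<close>

definition output_order :: "state \<Rightarrow> nat" where
  "output_order s = s 2 0"

definition output_class :: "nat pair_pre_digraph \<Rightarrow> state \<Rightarrow> nat \<Rightarrow> nat set" where
  "output_class G s i = {v \<in> pverts G. s 3 v = i}"

end

theory Submission
  imports Defs
begin

text \<open>
  A total transitive partition of order \<open>k\<close> is a labelling of the vertices by positive numbers with
  maximum \<open>k\<close> in which every vertex labelled \<open>l\<close> sees all of \<open>1, \<dots>, l\<close> among its neighbours. Cutting
  a labelling off at any \<open>t \<ge> 1\<close> keeps this property, so for an edge \<open>vp\<close> and a label \<open>i\<close> of \<open>p\<close>, the
  labels of \<open>v\<close> that extend to the branch at \<open>v\<close> form an initial segment \<open>1, \<dots>, m\<close>, and a table of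
  these \<open>m\<close> can be computed by dynamic programming. Whether \<open>v\<close> can get label \<open>l\<close> is a matching problem
  between the labels \<open>1, \<dots>, l\<close> (without \<open>i\<close>) and the other neighbours; since the admissible labels
  of each neighbour form an initial segment, assigning the labels greedily from \<open>l\<close> downwards solves
  it. Sweeping over the whole table \<open>n\<close> times makes a processing order of the directed edges
  unnecessary. The best root is then labelled with its table entry, and the labels are spread level
  by level with the same greedy assignment.
\<close>

section \<open>Programs with bounded loops\<close>

text \<open>The greedy assignment works because candidate sets are nested: a neighbour that can take
  label \<open>t\<close> can take every smaller label. The root of an optimal labelling is not known
  in advance, so branches are indexed by pairs \<open>v p\<close> in both directions of each edge
  instead of by recursion over one rooted tree. The induction measure is the number of vertices
  nearer to \<open>v\<close> than to \<open>p\<close>. It is expressed through distances, and a few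
  laws of the distance function carry all of the tree structure. Two conventions recur. The number 0
  stands for absence: no label assigned, no feasible label, no parent, vertex not yet reached. A
  neighbour that the matching leaves without a label receives 1, which is feasible as soon as any
  label is.\<close>

text \<open>\<open>For x p\<close> runs \<open>p\<close> with the counter \<open>x\<close> going from \<open>0\<close> to \<open>n - 1\<close>, where \<open>n\<close> is the input size
  held in array 0. Since no other loops are used, a polynomial time bound can be read off the
  syntax.\<close>

datatype prog =
    Store nat aexp aexp
  | Then prog prog (infixr \<open>;;\<close> 60)
  | When aexp prog
  | For nat prog

fun compile :: "prog \<Rightarrow> com" where
  "compile (Store x i e) = Assign x i e"
| "compile (p ;; q) = Seq (compile p) (compile q)"
| "compile (When e p) = If e (compile p) Skip"
| "compile (For x p) =
     Seq (Assign x (N 0) (N 0))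
       (While (Minus (Cell 0 (N 0)) (Cell x (N 0)))
         (Seq (compile p) (Assign x (N 0) (Plus (Cell x (N 0)) (N 1)))))"

text \<open>A named update keeps program states folded: reads are resolved by comparing array
  numbers alone.\<close>

definition put :: "state \<Rightarrow> nat \<Rightarrow> nat \<Rightarrow> nat \<Rightarrow> state" where
  "put s x i a = s(x := (s x)(i := a))"

lemma put_same [simp]: "put s x i a x = (s x)(i := a)"
  by (simp add: put_def)

lemma put_other [simp]: "y \<noteq> x \<Longrightarrow> put s x i a y = s y"
  by (simp add: put_def)

lemma exec_Store: "exec (Assign x i e) s 1 (put s x (aval i s) (aval e s))"
  unfolding put_def by (rule exec.Assign)

text \<open>The number of iterations is fixed on entry to a loop. This agrees with the compiled
  \<open>While\<close> because \<open>wf_prog\<close> forbids the body to write array 0 or the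
  counter.\<close>

fun sem :: "prog \<Rightarrow> state \<Rightarrow> state" where
  "sem (Store x i e) s = put s x (aval i s) (aval e s)"
| "sem (p ;; q) s = sem q (sem p s)"
| "sem (When e p) s = (if aval e s \<noteq> 0 then sem p s else s)"
| "sem (For x p) s =
     ((\<lambda>s. put (sem p s) x 0 (Suc (sem p s x 0))) ^^ s 0 0) (put s x 0 0)"

fun writes :: "prog \<Rightarrow> nat set" where
  "writes (Store x i e) = {x}"
| "writes (p ;; q) = writes p \<union> writes q"
| "writes (When e p) = writes p"
| "writes (For x p) = insert x (writes p)"

fun wf_prog :: "prog \<Rightarrow> bool" where
  "wf_prog (Store x i e) \<longleftrightarrow> x \<noteq> 0"
| "wf_prog (p ;; q) \<longleftrightarrow> wf_prog p \<and> wf_prog q"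
| "wf_prog (When e p) \<longleftrightarrow> wf_prog p"
| "wf_prog (For x p) \<longleftrightarrow> wf_prog p \<and> x \<noteq> 0 \<and> x \<notin> writes p"

text \<open>The polynomial \<open>[:0, 1:]\<close> is the input size. For \<open>When\<close>, 2
  covers the test and a possible \<open>Skip\<close>. For \<open>For\<close>, the outer 2 is the
  initial assignment and the failing last test, the inner 2 is one successful test and one increment
  per pass.\<close>

fun cost :: "prog \<Rightarrow> nat poly" where
  "cost (Store x i e) = 1"
| "cost (p ;; q) = cost p + cost q"
| "cost (When e p) = 2 + cost p"
| "cost (For x p) = 2 + [:0, 1:] * (cost p + 2)"

section \<open>Running time and loop rules\<close>

lemma zero_notin_writes: "wf_prog p \<Longrightarrow> 0 \<notin> writes p"
  by (induction p) auto

lemma sem_frame: "x \<notin> writes p \<Longrightarrow> sem p s x = s x"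
proof (induction p arbitrary: s)
  case (For y p)
  have "((\<lambda>s. put (sem p s) y 0 (Suc (sem p s y 0))) ^^ k) r x = r x" for k r
    using For by (induction k) auto
  then show ?case using For.prems by simp
qed auto

lemma sem_input_size: "wf_prog p \<Longrightarrow> sem p s 0 = s 0"
  by (simp add: sem_frame zero_notin_writes)

lemma exec_compile:
  assumes "wf_prog p"
  shows "\<exists>t. exec (compile p) s t (sem p s) \<and> t \<le> poly (cost p) (s 0 0)"
  using assms
proof (induction p arbitrary: s)
  case (Store x i e)
  show ?case using exec_Store[of x i e s] by auto
next
  case (Then p q)
  obtain t1 where t1: "exec (compile p) s t1 (sem p s)" "t1 \<le> poly (cost p) (s 0 0)"
    using Then by force
  obtain t2 where t2: "exec (compile q) (sem p s) t2 (sem q (sem p s))"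
      "t2 \<le> poly (cost q) (sem p s 0 0)"
    using Then by force
  have "sem p s 0 = s 0" using Then.prems by (simp add: sem_input_size)
  then show ?case using exec.Seq[OF t1(1) t2(1)] t1(2) t2(2) by (intro exI[of _ "t1 + t2"]) auto
next
  case (When e p)
  show ?case
  proof (cases "aval e s = 0")
    case True
    have "exec (compile (When e p)) s (1 + 1) (sem (When e p) s)"
      unfolding compile.simps sem.simps using exec.IfFalse[OF True exec.Skip] True by presburger
    moreover have "1 + 1 \<le> poly (cost (When e p)) (s 0 0)" by simp
    ultimately show ?thesis by blast
  next
    case False
    obtain t where t: "exec (compile p) s t (sem p s)" "t \<le> poly (cost p) (s 0 0)"
      using When by force
    then show ?thesis using exec.IfTrue[OF False t(1), of Skip] False
      by (intro exI[of _ "1 + t"]) auto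
  qed
next
  case (For x p)
  let ?e = "Minus (Cell 0 (N 0)) (Cell x (N 0))"
  let ?c = "Seq (compile p) (Assign x (N 0) (Plus (Cell x (N 0)) (N 1)))"
  let ?F = "\<lambda>s. put (sem p s) x 0 (Suc (sem p s x 0))"
  define B where "B = poly (cost p) (s 0 0)"
  \<comment> \<open>Generalised to a loop entered with \<open>k\<close> passes left. One bound
    \<open>B\<close> serves for all passes because array 0 never changes.\<close>
  have loop: "\<exists>t. exec (While ?e ?c) r t ((?F ^^ k) r) \<and> t \<le> 1 + k * (B + 2)"
    if "r 0 0 = s 0 0" "r x 0 + k = s 0 0" for k r
    using that
  proof (induction k arbitrary: r)
    case 0
    then show ?case using exec.WhileFalse[of ?e r ?c] by auto
  next
    case (Suc k)
    obtain t where t: "exec (compile p) r t (sem p r)" "t \<le> poly (cost p) (r 0 0)"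
      using For by force
    have body: "exec ?c r (t + 1) (?F r)"
      using exec.Seq[OF t(1) exec_Store[of x "N 0" "Plus (Cell x (N 0)) (N 1)"]] by simp
    have fr: "sem p r 0 = r 0" "sem p r x = r x"
      using For.prems by (simp_all add: sem_input_size sem_frame)
    obtain t' where t': "exec (While ?e ?c) (?F r) t' ((?F ^^ k) (?F r))" "t' \<le> 1 + k * (B + 2)"
    proof -
      have "?F r 0 0 = s 0 0" "?F r x 0 + k = s 0 0" using Suc.prems fr For.prems by simp_all
      from Suc.IH[of "?F r", OF this] that show ?thesis by blast
    qed
    have "exec (While ?e ?c) r (1 + (t + 1) + t') ((?F ^^ k) (?F r))"
      by (rule exec.WhileTrue[OF _ body t'(1)]) (use Suc.prems in simp)
    moreover have "1 + (t + 1) + t' \<le> 1 + Suc k * (B + 2)"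
      using t(2) t'(2) Suc.prems by (simp add: B_def)
    ultimately show ?case unfolding funpow_Suc_right o_apply by blast
  qed
  let ?r = "put s x 0 0"
  obtain t where t: "exec (While ?e ?c) ?r t ((?F ^^ s 0 0) ?r)" "t \<le> 1 + s 0 0 * (B + 2)"
  proof -
    have "?r 0 0 = s 0 0" "?r x 0 + s 0 0 = s 0 0" using For.prems by simp_all
    from loop[of ?r, OF this] that show ?thesis by blast
  qed
  have "exec (compile (For x p)) s (1 + t) (sem (For x p) s)"
    unfolding compile.simps sem.simps
    by (rule exec.Seq[OF exec_Store[of x "N 0" "N 0" s, unfolded aval.simps] t(1)])
  moreover have "1 + t \<le> poly (cost (For x p)) (s 0 0)" using t(2) by (simp add: B_def)
  ultimately show ?case by blast
qed

text \<open>The step may assume that every array outside \<open>writes p\<close> is still as in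
  \<open>s\<close>, so invariants need only describe what the body modifies.\<close>

lemma For_invariant:
  assumes "wf_prog (For x p)" and n: "s 0 0 = n"
    and "I 0 (put s x 0 0)"
    and step: "\<And>i r. i < n \<Longrightarrow> r 0 0 = n \<Longrightarrow> r x 0 = i \<Longrightarrow>
        (\<And>y. y \<notin> insert x (writes p) \<Longrightarrow> r y = s y) \<Longrightarrow> I i r \<Longrightarrow>
        I (Suc i) (put (sem p r) x 0 (Suc i))"
  shows "I n (sem (For x p) s)"
proof -
  let ?F = "\<lambda>s. put (sem p s) x 0 (Suc (sem p s x 0))"
  let ?s = "put s x 0 0"
  have wf: "wf_prog p" "x \<noteq> 0" "x \<notin> writes p" using assms(1) by auto
  have "I i ((?F ^^ i) ?s) \<and> (?F ^^ i) ?s x 0 = i \<and> (?F ^^ i) ?s 0 0 = n \<and>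
      (\<forall>y. y \<notin> insert x (writes p) \<longrightarrow> (?F ^^ i) ?s y = s y)" if "i \<le> n" for i
    using that
  proof (induction i)
    case 0
    then show ?case using assms wf by simp
  next
    case (Suc i)
    let ?r = "(?F ^^ i) ?s"
    have r: "I i ?r" "?r x 0 = i" "?r 0 0 = n" "\<And>y. y \<notin> insert x (writes p) \<Longrightarrow> ?r y = s y"
      using Suc by auto
    have fr: "sem p ?r 0 = ?r 0" "sem p ?r x = ?r x"
      using wf by (simp_all add: sem_input_size sem_frame)
    have eq: "(?F ^^ Suc i) ?s = put (sem p ?r) x 0 (Suc i)"
      using fr r by simp
    have "I (Suc i) (put (sem p ?r) x 0 (Suc i))"
      by (rule step[of i ?r]) (use r Suc.prems in simp_all)
    moreover have "put (sem p ?r) x 0 (Suc i) y = s y" if "y \<notin> insert x (writes p)" for y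
      using that r(4)[OF that] by (simp add: sem_frame)
    ultimately show ?case unfolding eq using fr(1) r(3) wf by simp
  qed
  from this[of n] show ?thesis using n by simp
qed

text \<open>For loops in which pass \<open>i\<close> achieves \<open>Q i\<close> on its own: what
  has to be shown is that a pass does not destroy the goals of earlier passes.\<close>

lemma For_each:
  assumes wf: "wf_prog (For x p)" and n: "s 0 0 = n"
    and init: "J (put s x 0 0)"
    and step: "\<And>i r. i < n \<Longrightarrow> r 0 0 = n \<Longrightarrow> r x 0 = i \<Longrightarrow>
        (\<And>y. y \<notin> insert x (writes p) \<Longrightarrow> r y = s y) \<Longrightarrow> J r \<Longrightarrow>
        J (put (sem p r) x 0 (Suc i)) \<and>
        Q i (put (sem p r) x 0 (Suc i)) \<and>
        (\<forall>j<i. Q j r \<longrightarrow> Q j (put (sem p r) x 0 (Suc i)))"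
  shows "J (sem (For x p) s) \<and> (\<forall>i<n. Q i (sem (For x p) s))"
proof (rule For_invariant[where I = "\<lambda>i s. J s \<and> (\<forall>j<i. Q j s)" and s = s, OF wf n])
  show "J (put s x 0 0) \<and> (\<forall>j<0. Q j (put s x 0 0))" using init by simp
next
  fix i r
  assume a: "i < n" "r 0 0 = n" "r x 0 = i" "\<And>y. y \<notin> insert x (writes p) \<Longrightarrow> r y = s y"
    and b: "J r \<and> (\<forall>j<i. Q j r)"
  let ?r = "put (sem p r) x 0 (Suc i)"
  have *: "J ?r \<and> Q i ?r \<and> (\<forall>j<i. Q j r \<longrightarrow> Q j ?r)"
    by (rule step[OF a]) (use b in simp_all)
  have "Q j ?r" if "j < Suc i" for j
    using that * b by (cases "j = i") simp_all
  then show "J ?r \<and> (\<forall>j<Suc i. Q j ?r)" using * by simp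
qed

section \<open>Distances in trees\<close>

text \<open>What later arguments use of a tree. For every root \<open>r\<close>, no edge joins
  equidistant vertices (\<open>d_step\<close>), and each other vertex has exactly one neighbour
  closer to \<open>r\<close>: existence reflects connectedness, uniqueness the absence of
  cycles.\<close>

locale tree_dist =
  fixes n :: nat and E :: "nat \<Rightarrow> nat \<Rightarrow> bool" and d :: "nat \<Rightarrow> nat \<Rightarrow> nat"
  assumes E_less: "E u v \<Longrightarrow> u < n \<and> v < n"
    and E_sym: "E u v \<Longrightarrow> E v u"
    and E_irrefl: "\<not> E v v"
    and d_sym: "d u v = d v u"
    and d_zero: "u < n \<Longrightarrow> v < n \<Longrightarrow> d u v = 0 \<longleftrightarrow> u = v"
    and d_step: "r < n \<Longrightarrow> E u v \<Longrightarrow> d r u = Suc (d r v) \<or> d r v = Suc (d r u)"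
    and closer_ex: "r < n \<Longrightarrow> v < n \<Longrightarrow> v \<noteq> r \<Longrightarrow> \<exists>u. E v u \<and> d r v = Suc (d r u)"
    and closer_unique: "r < n \<Longrightarrow> E v u \<Longrightarrow> E v u' \<Longrightarrow>
      d r v = Suc (d r u) \<Longrightarrow> d r v = Suc (d r u') \<Longrightarrow> u = u'"

text \<open>A walk from \<open>x\<close> to \<open>y\<close> that avoids \<open>v\<close> shortens
  to a path, which the two arcs at \<open>v\<close> close to a cycle. As
  \<open>x \<noteq> y\<close>, the path has at least one arc, so the length is at least 3.\<close>

lemma (in pair_graph) cycle_through_vertex:
  assumes vx: "(v, x) \<in> parcs G" and yv: "(y, v) \<in> parcs G" and "x \<noteq> y"
    and w: "(x, y) \<in> {(a, b) \<in> parcs G. a \<noteq> v \<and> b \<noteq> v}\<^sup>*"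
  shows "\<exists>p. cycle p \<and> 3 \<le> length p"
proof -
  have xv: "x \<noteq> v" using vx pair_no_loops by fastforce
  have "\<exists>p. awalk x p y \<and> set p \<subseteq> {(a, b) \<in> parcs G. a \<noteq> v \<and> b \<noteq> v}"
    using w
  proof (induction rule: rtrancl_induct)
    case base
    show ?case using vx by (intro exI[of _ "[]"]) (auto simp: awalk_Nil_iff dest: in_arcsD2)
  next
    case (step a b)
    then obtain p where p: "awalk x p a" "set p \<subseteq> {(a, b) \<in> parcs G. a \<noteq> v \<and> b \<noteq> v}" by blast
    have "awalk a [(a, b)] b" using step(2) by (auto simp: awalk_simps dest: in_arcsD1 in_arcsD2)
    from awalk_appendI[OF p(1) this] show ?case using p(2) step(2)
      by (intro exI[of _ "p @ [(a, b)]"]) auto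
  qed
  then obtain q where q: "awalk x q y" "set q \<subseteq> {(a, b) \<in> parcs G. a \<noteq> v \<and> b \<noteq> v}" by blast
  define p where "p = awalk_to_apath q"
  have p: "apath x p y" "set p \<subseteq> {(a, b) \<in> parcs G. a \<noteq> v \<and> b \<noteq> v}"
    using apath_awalk_to_apath[OF q(1)] awalk_to_apath_subset[OF q(1)] q(2) by (auto simp: p_def)
  have ne: "p \<noteq> []" using p(1) \<open>x \<noteq> y\<close> by (auto simp: apath_Nil_iff)
  have aw: "awalk x p y" and dist: "distinct (pawalk_verts x p)" using p(1) by (auto simp: apath_def)
  have vnot: "v \<notin> set (pawalk_verts x p)"
    using set_awalk_verts_not_Nil[OF aw ne] p(2) by auto
  have aw2: "awalk x (p @ [(y, v)]) v"
    using awalk_appendI[OF aw, of "[(y, v)]" v] yv by (auto simp: awalk_simps dest: in_arcsD1 in_arcsD2)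
  have "awalk v ((v, x) # p @ [(y, v)]) v"
    using aw2 vx by (auto simp: awalk_Cons_iff dest: in_arcsD1)
  moreover have "pawalk_verts x (p @ [(y, v)]) = pawalk_verts x p @ [v]"
    using awalk_verts_append[OF aw2] by simp
  ultimately have "cycle ((v, x) # p @ [(y, v)])"
    unfolding cycle_def using dist vnot by (intro exI[of _ v]) auto
  moreover have "3 \<le> length ((v, x) # p @ [(y, v)])" using ne by (cases p) auto
  ultimately show ?thesis by blast
qed

text \<open>Length of a shortest walk. For unconnected pairs \<open>LEAST\<close> is unspecified, so
  it is evaluated on connected graphs.\<close>

definition graph_dist :: "'a rel \<Rightarrow> 'a \<Rightarrow> 'a \<Rightarrow> nat" where
  "graph_dist A u v = (LEAST k. (u, v) \<in> A ^^ k)"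

lemma graph_dist_relpow: "(u, v) \<in> A\<^sup>* \<Longrightarrow> (u, v) \<in> A ^^ graph_dist A u v"
  unfolding graph_dist_def by (rule LeastI_ex) (auto simp: rtrancl_power)

lemma graph_dist_le: "(u, v) \<in> A ^^ k \<Longrightarrow> graph_dist A u v \<le> k"
  unfolding graph_dist_def by (rule Least_le)

lemma graph_dist_commute:
  assumes "sym A"
  shows "graph_dist A u v = graph_dist A v u"
proof -
  have "(a, b) \<in> A ^^ k \<Longrightarrow> (b, a) \<in> A ^^ k" for k a b
  proof (induction k arbitrary: b)
    case (Suc k)
    then obtain c where "(a, c) \<in> A ^^ k" "(c, b) \<in> A" by auto
    then show ?case using Suc.IH assms by (intro relpow_Suc_I2[of b c]) (auto dest: symD)
  qed simp
  then have "(u, v) \<in> A ^^ k \<longleftrightarrow> (v, u) \<in> A ^^ k" for k by blast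
  then show ?thesis by (simp add: graph_dist_def)
qed

lemma tree_dist_of_undirected_tree:
  assumes tree: "undirected_tree T" and V: "pverts T = {0..<n}"
  shows "tree_dist n (\<lambda>u v. (u, v) \<in> parcs T) (graph_dist (parcs T))"
proof -
  interpret pair_graph T using tree by (simp add: undirected_tree_def)
  let ?A = "parcs T" and ?d = "graph_dist (parcs T)"
  have sym: "sym ?A" using pair_sym_arcs by (simp add: symmetric_def)
  have symD: "(a, b) \<in> ?A \<Longrightarrow> (b, a) \<in> ?A" for a b using sym by (auto dest: symD)
  have verts: "a < n" "b < n" if "(a, b) \<in> ?A" for a b
    using that V in_arcsD1 in_arcsD2 by auto
  \<comment> \<open>Connectedness is stated for the symmetric closure, which here is the graph
    itself.\<close>
  have mk: "parcs (mk_symmetric (with_proj T)) = ?A" "pverts (mk_symmetric (with_proj T)) = {0..<n}"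
    using V symD by (fastforce simp: mk_symmetric_def)+
  have conn: "(a, b) \<in> ?A\<^sup>*" if "a < n" "b < n" for a b
  proof -
    have "strongly_connected (with_proj (mk_symmetric (with_proj T)))"
      using tree by (simp add: undirected_tree_def Digraph_Component.connected_def)
    then have "(a, b) \<in> rtrancl_on {0..<n} ?A"
      using that V by (auto simp: strongly_connected_def Digraph.reachable_def mk)
    then show ?thesis by (rule rtrancl_on_rtranclI)
  qed
  have rel: "(a, b) \<in> ?A ^^ ?d a b" if "a < n" "b < n" for a b
    using graph_dist_relpow[OF conn[OF that]] .
  have le: "?d r b \<le> Suc (?d r a)" if "r < n" "(a, b) \<in> ?A" for r a b
    using graph_dist_le[of r b "Suc (?d r a)" ?A] rel[of r a] verts that by auto
  have closer: "\<exists>u. (v, u) \<in> ?A \<and> ?d r v = Suc (?d r u)"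
    if rv: "r < n" "v < n" "v \<noteq> r" for r v
  proof (cases "?d r v")
    case 0
    then show ?thesis using rel[of r v] that by auto
  next
    case (Suc k)
    then obtain u where u: "(r, u) \<in> ?A ^^ k" "(u, v) \<in> ?A" using rel[of r v] rv by auto
    have "?d r u \<le> k" using graph_dist_le[OF u(1)] .
    moreover have "?d r v \<le> Suc (?d r u)" using le[OF that(1) u(2)] .
    ultimately show ?thesis using Suc u symD by (intro exI[of _ u]) auto
  qed
  \<comment> \<open>Walking from \<open>x\<close> to ever closer vertices cannot meet
    \<open>v\<close>: after the first step the distance to \<open>r\<close> is below
    \<open>?d r v\<close>.\<close>
  have descend: "(x, r) \<in> {(a, b) \<in> ?A. a \<noteq> v \<and> b \<noteq> v}\<^sup>*"
    if "r < n" "x < n" "x \<noteq> v" "?d r x \<le> ?d r v" for r x v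
    using that
  proof (induction "?d r x" arbitrary: x rule: less_induct)
    case less
    show ?case
    proof (cases "x = r")
      case False
      then obtain u where u: "(x, u) \<in> ?A" "?d r x = Suc (?d r u)" using closer less.prems by blast
      have "u \<noteq> v" using u less.prems by auto
      moreover have "(u, r) \<in> {(a, b) \<in> ?A. a \<noteq> v \<and> b \<noteq> v}\<^sup>*"
        using less.hyps[of u] less.prems u \<open>u \<noteq> v\<close> verts by auto
      ultimately show ?thesis using u less.prems by (auto intro: converse_rtrancl_into_rtrancl)
    qed simp
  qed
  \<comment> \<open>The only use of acyclicity: two neighbours of \<open>v\<close> no farther from
    \<open>r\<close> than \<open>v\<close> would be joined through \<open>r\<close> by a walk
    avoiding \<open>v\<close>. The non-strict bounds give both \<open>d_step\<close> and
    \<open>closer_unique\<close>.\<close>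
  have only: "x = y"
    if "r < n" "(v, x) \<in> ?A" "(v, y) \<in> ?A" "?d r x \<le> ?d r v" "?d r y \<le> ?d r v" for r v x y
  proof (rule ccontr)
    let ?R = "{(a, b) \<in> ?A. a \<noteq> v \<and> b \<noteq> v}"
    assume "x \<noteq> y"
    have ne: "x \<noteq> v" "y \<noteq> v" using that pair_no_loops by fastforce+
    have "(x, r) \<in> ?R\<^sup>*" "(y, r) \<in> ?R\<^sup>*" using descend that verts ne by blast+
    moreover have "sym ?R" using symD by (auto intro!: symI)
    ultimately have "(x, y) \<in> ?R\<^sup>*" by (meson rtrancl_trans sym_rtrancl symE)
    then have "\<exists>p. cycle p \<and> 3 \<le> length p"
      using cycle_through_vertex[of v x y] that symD \<open>x \<noteq> y\<close> by blast
    then show False using tree by (simp add: undirected_tree_def)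
  qed
  show ?thesis
  proof
    fix u v r u'
    show "(u, v) \<in> ?A \<Longrightarrow> u < n \<and> v < n" using verts by blast
    show "(u, v) \<in> ?A \<Longrightarrow> (v, u) \<in> ?A" by (rule symD)
    show "(v, v) \<notin> ?A" using pair_no_loops by fastforce
    show "?d u v = ?d v u" by (rule graph_dist_commute[OF sym])
    show zero: "?d u v = 0 \<longleftrightarrow> u = v" if "u < n" "v < n"
      using rel[OF that] graph_dist_le[of u u 0 ?A] by auto
    show "?d r u = Suc (?d r v) \<or> ?d r v = Suc (?d r u)" if e: "r < n" "(u, v) \<in> ?A"
    proof (rule ccontr)
      assume no: "\<not> ?thesis"
      have "?d r u = ?d r v" using no le[OF that] le[OF that(1) symD[OF that(2)]] by linarith
      moreover have "u \<noteq> r \<or> v \<noteq> r" using that pair_no_loops by fastforce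
      ultimately have "u \<noteq> r" using rel[of r v] that verts graph_dist_le[of r r 0 ?A] by auto
      \<comment> \<open>If \<open>u\<close> and \<open>v\<close> were equidistant, \<open>w\<close>
        and \<open>v\<close> would be two neighbours of \<open>u\<close> that are no farther than
        \<open>u\<close>.\<close>
      then obtain w where w: "(u, w) \<in> ?A" "?d r u = Suc (?d r w)"
        using closer e verts by blast
      have "w = v" using only[of r u w v] w that \<open>?d r u = ?d r v\<close> by simp
      then show False using w \<open>?d r u = ?d r v\<close> by simp
    qed
    show "r < n \<Longrightarrow> v < n \<Longrightarrow> v \<noteq> r \<Longrightarrow> \<exists>u. (v, u) \<in> ?A \<and> ?d r v = Suc (?d r u)"
      by (rule closer)
    show "r < n \<Longrightarrow> (v, u) \<in> ?A \<Longrightarrow> (v, u') \<in> ?A \<Longrightarrow> ?d r v = Suc (?d r u) \<Longrightarrow>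
        ?d r v = Suc (?d r u') \<Longrightarrow> u = u'"
      by (rule only[of r v]) auto
  qed
qed

section \<open>Sizes of branches\<close>

context tree_dist
begin

text \<open>Descending from \<open>v\<close> to \<open>r\<close> meets every distance from
  \<open>d r v\<close> to 0, which takes \<open>d r v + 1\<close> different vertices.\<close>

lemma d_less:
  assumes "r < n" "v < n"
  shows "d r v < n"
proof -
  have "\<exists>w<n. d r w = d r v - k" if "k \<le> d r v" for k
    using that
  proof (induction k)
    case 0
    then show ?case using assms by auto
  next
    case (Suc k)
    then obtain w where w: "w < n" "d r w = d r v - k" by auto
    with Suc.prems have "w \<noteq> r" using d_zero[of r r] assms by auto
    with closer_ex[OF assms(1) w(1)] obtain u where "E w u" "d r w = Suc (d r u)" by blast
    then show ?case using w E_less by (intro exI[of _ u]) auto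
  qed
  from this[of "d r v - _"] have "{..d r v} \<subseteq> d r ` {..<n}"
    by (auto simp: image_iff) (metis diff_diff_cancel diff_le_self lessThan_iff)
  then have "card {..d r v} \<le> card {..<n}" by (rule surj_card_le[rotated]) simp
  then show ?thesis by simp
qed

text \<open>Pairs that are not edges stand for the whole tree rooted at \<open>v\<close>.\<close>

definition branch_size :: "nat \<Rightarrow> nat \<Rightarrow> nat" where
  "branch_size v p = (if E v p then card {w. w < n \<and> d v w < d p w} else n)"

lemma branch_size_le: "v < n \<Longrightarrow> branch_size v p \<le> n"
  using card_mono[of "{..<n}" "{w. w < n \<and> d v w < d p w}"] by (auto simp: branch_size_def)

text \<open>If \<open>w\<close> lies beyond \<open>u\<close>, then \<open>u\<close> is the unique
  neighbour of \<open>v\<close> closer to \<open>w\<close>, so \<open>p\<close> is farther from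
  \<open>w\<close> than \<open>v\<close> is. Hence the branch at \<open>u\<close> is contained in
  the branch at \<open>v\<close>, and it misses \<open>v\<close>.\<close>

lemma branch_size_decreasing:
  assumes "E v u" "u \<noteq> p"
  shows "branch_size u v < branch_size v p"
proof -
  have lt: "u < n" "v < n" and "E u v" using assms E_less E_sym by blast+
  have sz: "branch_size u v = card {w. w < n \<and> d u w < d v w}"
    using \<open>E u v\<close> by (simp add: branch_size_def)
  have out: "v \<notin> {w. w < n \<and> d u w < d v w}" using d_zero[of v v] lt by simp
  show ?thesis
  proof (cases "E v p")
    case True
    have "{w. w < n \<and> d u w < d v w} \<subseteq> {w. w < n \<and> d v w < d p w}"
    proof clarify
      fix w assume w: "w < n" "d u w < d v w"
      then have 1: "d w v = Suc (d w u)" using d_step[OF w(1) \<open>E u v\<close>] by (auto simp: d_sym)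
      have "d w v \<noteq> Suc (d w p)" using closer_unique[OF w(1) assms(1) True 1] assms(2) by blast
      then show "d v w < d p w" using d_step[OF w(1) True] by (auto simp: d_sym)
    qed
    moreover have "v \<in> {w. w < n \<and> d v w < d p w}"
      using lt d_zero[of v v] d_zero[of p v] True E_less E_irrefl by (metis (mono_tags) mem_Collect_eq neq0_conv)
    ultimately have "{w. w < n \<and> d u w < d v w} \<subset> {w. w < n \<and> d v w < d p w}" using out by blast
    then show ?thesis using True sz by (simp add: branch_size_def psubset_card_mono)
  next
    case False
    have "{w. w < n \<and> d u w < d v w} \<subset> {..<n}" using out lt by blast
    then have "card {w. w < n \<and> d u w < d v w} < card {..<n}" by (intro psubset_card_mono) auto
    then show ?thesis using False sz by (simp add: branch_size_def)
  qed
qed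

section \<open>Extendable labels\<close>

definition others :: "nat \<Rightarrow> nat \<Rightarrow> nat set" where
  "others v p = {u. E v u \<and> u \<noteq> p}"

text \<open>\<open>feasible v p l i\<close>: the branch hanging off \<open>p\<close> at \<open>v\<close> can be labelled with \<open>l\<close> at \<open>v\<close> if \<open>p\<close> has
  label \<open>i\<close>. The whole tree rooted at \<open>v\<close> is the case \<open>p = v\<close>, \<open>i = 0\<close>.\<close>

inductive feasible :: "nat \<Rightarrow> nat \<Rightarrow> nat \<Rightarrow> nat \<Rightarrow> bool" where
  "1 \<le> l \<Longrightarrow> l < n \<Longrightarrow> \<forall>u\<in>others v p. feasible u v (g u) l \<Longrightarrow>
    {1..l} \<subseteq> insert i (g ` others v p) \<Longrightarrow> feasible v p l i"

lemma feasible_iff: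
  "feasible v p l i \<longleftrightarrow> 1 \<le> l \<and> l < n \<and>
    (\<exists>g. (\<forall>u\<in>others v p. feasible u v (g u) l) \<and> {1..l} \<subseteq> insert i (g ` others v p))"
  by (subst feasible.simps) auto

text \<open>Cutting all labels off at \<open>t\<close> preserves feasibility, because labels up to \<open>t\<close> are still
  represented by the same neighbours.\<close>

lemma feasible_truncate:
  "feasible v p l i \<Longrightarrow> 1 \<le> t \<Longrightarrow> feasible v p (min l t) (min i t)"
proof (induction rule: feasible.induct)
  case (1 l v p g i)
  have "{1..min l t} \<subseteq> insert (min i t) ((\<lambda>u. min (g u) t) ` others v p)"
  proof
    fix j assume j: "j \<in> {1..min l t}"
    then have "j \<in> insert i (g ` others v p)" by (intro subsetD[OF 1(3)]) simp
    then show "j \<in> insert (min i t) ((\<lambda>u. min (g u) t) ` others v p)" using j by force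
  qed
  then show ?case using 1 by (intro feasible.intros[where g = "\<lambda>u. min (g u) t"]) auto
qed

text \<open>\<open>feasible_truncate\<close> would also cut the label \<open>i\<close> of the
  parent. It is therefore applied only to the branches below \<open>v\<close>, and the topmost step
  is rebuilt with \<open>i\<close> unchanged.\<close>

lemma feasible_downward:
  assumes "feasible v p l i" "1 \<le> l'" "l' \<le> l"
  shows "feasible v p l' i"
  using assms(1)
proof cases
  case (1 g)
  show ?thesis
  proof (rule feasible.intros[where g = "\<lambda>u. min (g u) l'"])
    show "1 \<le> l'" "l' < n" using assms 1 by auto
    have "min l l' = l'" using assms by simp
    then show "\<forall>u\<in>others v p. feasible u v (min (g u) l') l'"
      using feasible_truncate[of _ v _ l l'] 1(3) assms(2) by force
    show "{1..l'} \<subseteq> insert i ((\<lambda>u. min (g u) l') ` others v p)"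
    proof
      fix j assume j: "j \<in> {1..l'}"
      then have "j \<in> insert i (g ` others v p)" using assms by (intro subsetD[OF 1(4)]) simp
      then show "j \<in> insert i ((\<lambda>u. min (g u) l') ` others v p)" using j by force
    qed
  qed
qed

section \<open>Total labellings and assignments of labels\<close>

definition total_labelling :: "(nat \<Rightarrow> nat) \<Rightarrow> bool" where
  "total_labelling f \<longleftrightarrow> (\<forall>v<n. 1 \<le> f v \<and> (\<forall>j\<in>{1..f v}. \<exists>u. E v u \<and> f u = j))"

lemma total_labelling_neighbour:
  "total_labelling f \<Longrightarrow> v < n \<Longrightarrow> j \<in> {1..f v} \<Longrightarrow> \<exists>u. E v u \<and> f u = j"
  by (simp add: total_labelling_def)

text \<open>The labels from 1 to \<open>f v\<close> sit on that many different neighbours. This is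
  the source of \<open>l < n\<close> in \<open>feasible\<close>, which makes labels valid table
  indices.\<close>

lemma total_labelling_less:
  assumes "total_labelling f" "v < n"
  shows "f v < n"
proof -
  have "{1..f v} \<subseteq> f ` {u. E v u}"
  proof
    fix j assume "j \<in> {1..f v}"
    then obtain u where "E v u" "f u = j" using total_labelling_neighbour[OF assms] by blast
    then show "j \<in> f ` {u. E v u}" by auto
  qed
  moreover have sub: "{u. E v u} \<subseteq> {..<n} - {v}" using E_less E_irrefl by blast
  ultimately have "card {1..f v} \<le> card {u. E v u}"
    by (intro surj_card_le) (auto intro: finite_subset)
  also have "\<dots> \<le> card ({..<n} - {v})" using sub by (intro card_mono) auto
  also have "\<dots> < n" using assms by simp
  finally show ?thesis by simp
qed

text \<open>Induction over shrinking branches, with \<open>f\<close> itself as the witness at each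
  level. The value 0 for the missing parent of a root lies outside every \<open>{1..l}\<close> and
  so supplies nothing.\<close>

lemma total_labelling_feasible:
  assumes f: "total_labelling f" and "v < n" and "E v p \<or> p = v"
  shows "feasible v p (f v) (if E v p then f p else 0)"
  using assms(2,3)
proof (induction "branch_size v p" arbitrary: v p rule: less_induct)
  case less
  show ?case
  proof (rule feasible.intros[where g = f])
    show "1 \<le> f v" using f less by (auto simp: total_labelling_def)
    show "f v < n" using total_labelling_less[OF f] less by blast
    show "\<forall>u\<in>others v p. feasible u v (f u) (f v)"
      using less.hyps branch_size_decreasing E_less E_sym by (fastforce simp: others_def)
    show "{1..f v} \<subseteq> insert (if E v p then f p else 0) (f ` others v p)"
    proof
      fix j assume "j \<in> {1..f v}"
      then obtain u where u: "E v u" "f u = j"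
        using total_labelling_neighbour[OF f less.prems(1)] by blast
      show "j \<in> insert (if E v p then f p else 0) (f ` others v p)"
      proof (cases "u = p")
        case False
        then show ?thesis using u by (auto simp: others_def)
      qed (use u in simp)
    qed
  qed
qed

text \<open>The entry is the largest feasible label, with 0 for none; the initial-segment form is
  available thanks to \<open>feasible_downward\<close>.\<close>

definition table_ok :: "(nat \<Rightarrow> nat \<Rightarrow> nat \<Rightarrow> nat) \<Rightarrow> nat \<Rightarrow> nat \<Rightarrow> nat \<Rightarrow> bool" where
  "table_ok M v p i \<longleftrightarrow> (\<forall>l. feasible v p l i \<longleftrightarrow> 1 \<le> l \<and> l \<le> M v p i)"

text \<open>Capacity 0 excludes a vertex from the matching because all labels to be placed are
  positive. One function on \<open>{..<n}\<close> thus encodes both the set of candidates and their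
  bounds.\<close>

definition caps :: "(nat \<Rightarrow> nat \<Rightarrow> nat \<Rightarrow> nat) \<Rightarrow> nat \<Rightarrow> nat \<Rightarrow> nat \<Rightarrow> nat \<Rightarrow> nat" where
  "caps M v p l u = (if u \<in> others v p then M u v l else 0)"

text \<open>Here \<open>g u = 0\<close> means that \<open>u\<close> got no label in the matching. A
  nonzero table entry guarantees that label 1 is feasible for such a \<open>u\<close>, hence
  \<open>max 1 (g u)\<close>.\<close>

lemma feasible_of_assignment:
  assumes "1 \<le> l" "l < n" and tab: "\<forall>u\<in>others v p. table_ok M u v l"
    and pos: "\<forall>u\<in>others v p. M u v l \<noteq> 0"
    and cov: "{1..l} - {i} \<subseteq> g ` {..<n}" and cap: "\<forall>u<n. g u \<le> caps M v p l u"
  shows "\<forall>u\<in>others v p. feasible u v (max 1 (g u)) l"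
    and "{1..l} \<subseteq> insert i ((\<lambda>u. max 1 (g u)) ` others v p)"
    and "feasible v p l i"
proof -
  show 1: "\<forall>u\<in>others v p. feasible u v (max 1 (g u)) l"
  proof
    fix u assume u: "u \<in> others v p"
    then have "u < n" using E_less by (auto simp: others_def)
    then have "g u \<le> M u v l" using cap u by (force simp: caps_def)
    then show "feasible u v (max 1 (g u)) l"
      using u tab pos by (fastforce simp: table_ok_def)
  qed
  show 2: "{1..l} \<subseteq> insert i ((\<lambda>u. max 1 (g u)) ` others v p)"
  proof
    fix j assume j: "j \<in> {1..l}"
    show "j \<in> insert i ((\<lambda>u. max 1 (g u)) ` others v p)"
    proof (cases "j = i")
      case False
      then obtain u where u: "u < n" "j = g u" using j cov by blast
      then have "u \<in> others v p" using cap j by (force simp: caps_def split: if_splits)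
      then show ?thesis using u j by force
    qed simp
  qed
  show "feasible v p l i" by (rule feasible.intros[OF assms(1,2) 1 2])
qed

lemma assignment_of_feasible:
  assumes "feasible v p l i" and tab: "\<forall>u\<in>others v p. table_ok M u v l"
  shows "\<forall>u\<in>others v p. M u v l \<noteq> 0"
    and "\<exists>g. {1..l} - {i} \<subseteq> g ` {..<n} \<and> (\<forall>u<n. g u \<le> caps M v p l u)"
proof -
  obtain g where g: "\<forall>u\<in>others v p. feasible u v (g u) l" "{1..l} \<subseteq> insert i (g ` others v p)"
    using assms(1) by (auto simp: feasible_iff[of v])
  have le: "1 \<le> g u \<and> g u \<le> M u v l" if "u \<in> others v p" for u
    using that g(1) tab by (auto simp: table_ok_def)
  then show "\<forall>u\<in>others v p. M u v l \<noteq> 0" by fastforce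
  have "others v p \<subseteq> {..<n}" using E_less by (auto simp: others_def)
  then show "\<exists>g. {1..l} - {i} \<subseteq> g ` {..<n} \<and> (\<forall>u<n. g u \<le> caps M v p l u)"
    using g(2) le
    by (intro exI[of _ "\<lambda>u. if u \<in> others v p then g u else 0"]) (force simp: caps_def)
qed

end

section \<open>Greedy assignment of labels to neighbours\<close>

abbreviation (input) "row_arr \<equiv> 4 :: nat"
abbreviation (input) "tab_arr \<equiv> 5 :: nat"
abbreviation (input) "cap_arr \<equiv> 6 :: nat"
abbreviation (input) "asg_arr \<equiv> 7 :: nat"
abbreviation (input) "ok_var \<equiv> 8 :: nat"
abbreviation (input) "wit_var \<equiv> 9 :: nat"
abbreviation (input) "lbl_var \<equiv> 10 :: nat"
abbreviation (input) "u_var \<equiv> 11 :: nat"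
abbreviation (input) "j_var \<equiv> 12 :: nat"
abbreviation (input) "v_var \<equiv> 13 :: nat"
abbreviation (input) "p_var \<equiv> 14 :: nat"
abbreviation (input) "l_var \<equiv> 15 :: nat"
abbreviation (input) "i_var \<equiv> 16 :: nat"

abbreviation "Var x \<equiv> Cell x (N 0)"

text \<open>Subtraction on \<open>nat\<close> is truncated at 0: of the two differences at most one
  is nonzero.\<close>

definition neq :: "aexp \<Rightarrow> aexp \<Rightarrow> aexp" where
  "neq a b = Plus (Minus a b) (Minus b a)"

definition leq :: "aexp \<Rightarrow> aexp \<Rightarrow> aexp" where
  "leq a b = Minus (Plus b (N 1)) a"

definition is_zero :: "aexp \<Rightarrow> aexp" where
  "is_zero a = Minus (N 1) a"

lemma aval_tests [simp]:
  "0 < aval (neq a b) s \<longleftrightarrow> aval a s \<noteq> aval b s"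
  "0 < aval (leq a b) s \<longleftrightarrow> aval a s \<le> aval b s"
  "0 < aval (is_zero a) s \<longleftrightarrow> aval a s = 0"
  "aval (neq a b) s = 0 \<longleftrightarrow> aval a s = aval b s"
  "aval (leq a b) s = 0 \<longleftrightarrow> \<not> aval a s \<le> aval b s"
  "aval (is_zero a) s = 0 \<longleftrightarrow> aval a s \<noteq> 0"
  by (auto simp: neq_def leq_def is_zero_def)

text \<open>The language has no multiplication, so array 4 tabulates the multiples of \<open>n\<close>.\<close>

definition index2 :: "aexp \<Rightarrow> aexp \<Rightarrow> aexp" where
  "index2 a b = Plus (Cell row_arr a) b"

text \<open>The outer lookup is at position \<open>a * n + b\<close>, so \<open>row_arr\<close>
  needs \<open>n * n\<close> entries rather than \<open>n\<close>.\<close>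

definition index3 :: "aexp \<Rightarrow> aexp \<Rightarrow> aexp \<Rightarrow> aexp" where
  "index3 a b c = index2 (index2 a b) c"

text \<open>A neighbour with table entry 0 has no feasible label at all. This rules out label
  \<open>l\<close> at \<open>v\<close> even if the matching succeeds, so \<open>ok_var\<close> is
  cleared already here.\<close>

definition load_caps :: prog where
  "load_caps =
     Store ok_var (N 0) (N 1) ;;
     For u_var
      (Store cap_arr (Var u_var) (N 0) ;;
       When (Cell 1 (index2 (Var v_var) (Var u_var)))
        (When (neq (Var u_var) (Var p_var))
          (Store cap_arr (Var u_var) (Cell tab_arr (index3 (Var u_var) (Var v_var) (Var l_var))) ;;
           When (is_zero (Cell cap_arr (Var u_var))) (Store ok_var (N 0) (N 0)))))"

text \<open>The witness is stored as \<open>u + 1\<close>, so that 0 can report failure.\<close>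

definition search_free :: prog where
  "search_free =
     Store wit_var (N 0) (N 0) ;;
     For u_var
      (When (is_zero (Cell asg_arr (Var u_var)))
        (When (leq (Var lbl_var) (Cell cap_arr (Var u_var)))
          (Store wit_var (N 0) (Plus (Var u_var) (N 1)))))"

text \<open>With the counter \<open>j\<close> rising, \<open>l - j\<close> runs down from
  \<open>l\<close> and stays at 0 in the surplus passes, which do nothing. Label \<open>i\<close> is
  skipped since the parent already carries it.\<close>

definition assign_label :: prog where
  "assign_label =
     Store lbl_var (N 0) (Minus (Var l_var) (Var j_var)) ;;
     When (Var lbl_var)
      (When (neq (Var lbl_var) (Var i_var))
        (search_free ;;
         When (is_zero (Var wit_var)) (Store ok_var (N 0) (N 0)) ;;
         When (Var wit_var) (Store asg_arr (Minus (Var wit_var) (N 1)) (Var lbl_var))))"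

definition greedy :: prog where
  "greedy =
     load_caps ;;
     For u_var (Store asg_arr (Var u_var) (N 0)) ;;
     For j_var assign_label"

lemma writes_load_caps [simp]: "writes load_caps = {cap_arr, ok_var, u_var}"
  by (auto simp: load_caps_def)

lemma writes_search_free [simp]: "writes search_free = {wit_var, u_var}"
  by (auto simp: search_free_def)

lemma writes_assign_label [simp]:
  "writes assign_label = {asg_arr, ok_var, wit_var, lbl_var, u_var}"
  by (auto simp: assign_label_def)

lemma writes_greedy [simp]:
  "writes greedy = {cap_arr, asg_arr, ok_var, wit_var, lbl_var, u_var, j_var}"
  by (auto simp: greedy_def)

lemma wf_greedy [simp]:
  "wf_prog load_caps" "wf_prog search_free" "wf_prog assign_label" "wf_prog greedy"
  by (simp_all add: greedy_def load_caps_def search_free_def assign_label_def)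

section \<open>Optimality of the greedy choice\<close>

lemma search_free_correct:
  assumes "s 0 0 = n"
  shows "sem search_free s wit_var 0 = 0 \<and>
        (\<forall>u<n. s asg_arr u \<noteq> 0 \<or> s cap_arr u < s lbl_var 0) \<or>
      (\<exists>u<n. sem search_free s wit_var 0 = Suc u \<and> s asg_arr u = 0 \<and>
        s lbl_var 0 \<le> s cap_arr u)"
proof -
  let ?p = "When (is_zero (Cell asg_arr (Var u_var)))
        (When (leq (Var lbl_var) (Cell cap_arr (Var u_var)))
          (Store wit_var (N 0) (Plus (Var u_var) (N 1))))"
  let ?I = "\<lambda>k r. r wit_var 0 = 0 \<and>
        (\<forall>u<k. s asg_arr u \<noteq> 0 \<or> s cap_arr u < s lbl_var 0) \<or>
      (\<exists>u<k. r wit_var 0 = Suc u \<and> s asg_arr u = 0 \<and> s lbl_var 0 \<le> s cap_arr u)"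
  let ?s = "put s wit_var 0 0"
  have "?I n (sem (For u_var ?p) ?s)"
  proof (rule For_invariant[where I = ?I and s = ?s])
    fix i r
    assume "i < n" "r u_var 0 = i" and fr: "\<And>y. y \<notin> insert u_var (writes ?p) \<Longrightarrow> r y = ?s y"
      and I: "?I i r"
    have "r asg_arr = s asg_arr" "r cap_arr = s cap_arr" "r lbl_var = s lbl_var"
      by (simp_all add: fr)
    then show "?I (Suc i) (put (sem ?p r) u_var 0 (Suc i))"
      using I \<open>r u_var 0 = i\<close> by (auto simp: less_Suc_eq)
  qed (use assms in simp_all)
  then show ?thesis by (simp add: search_free_def)
qed

text \<open>The greedy choice cannot get stuck: a valid assignment \<open>g\<close> puts
  \<open>t\<close> and the labels \<open>P\<close> above it on \<open>card P + 1\<close> different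
  vertices, all of capacity at least \<open>t\<close>, while at most \<open>card P\<close> vertices
  are taken.\<close>

lemma free_neighbour_exists:
  fixes g C A :: "nat \<Rightarrow> nat"
  assumes cov: "insert t P \<subseteq> g ` {..<n}" and above: "\<forall>x\<in>P. t < x" and "finite P"
    and cap: "\<forall>u<n. g u \<le> C u" and few: "card {u. u < n \<and> A u \<noteq> 0} \<le> card P"
  shows "\<exists>u<n. A u = 0 \<and> t \<le> C u"
proof (rule ccontr)
  assume no: "\<not> ?thesis"
  have "insert t P \<subseteq> g ` {u. u < n \<and> A u \<noteq> 0}"
  proof
    fix x assume x: "x \<in> insert t P"
    then obtain u where u: "u < n" "x = g u" using cov by blast
    have "t \<le> x" using x above by force
    then have "t \<le> C u" using u cap by force
    then show "x \<in> g ` {u. u < n \<and> A u \<noteq> 0}" using u no by blast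
  qed
  then have "card (insert t P) \<le> card {u. u < n \<and> A u \<noteq> 0}"
    by (intro surj_card_le) auto
  moreover have "t \<notin> P" using above by blast
  ultimately show False using few \<open>finite P\<close> by simp
qed

lemma assign_labels_correct:
  fixes s :: state and n l i :: nat
  assumes n: "s 0 0 = n" and l: "s l_var 0 = l" "l < n" and i: "s i_var 0 = i"
    and asg: "\<forall>u<n. s asg_arr u = 0"
    and L_def: "L = {1..l} - {i}"
  defines "s' \<equiv> sem (For j_var assign_label) s"
  shows "\<forall>u<n. s' asg_arr u \<le> s cap_arr u"
    and "s' ok_var 0 \<noteq> 0 \<longleftrightarrow>
      s ok_var 0 \<noteq> 0 \<and> (\<exists>g. L \<subseteq> g ` {..<n} \<and> (\<forall>u<n. g u \<le> s cap_arr u))"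
    and "s' ok_var 0 \<noteq> 0 \<Longrightarrow> L \<subseteq> s' asg_arr ` {..<n}"
proof -
  define H where "H \<longleftrightarrow> (\<exists>g. L \<subseteq> g ` {..<n} \<and> (\<forall>u<n. g u \<le> s cap_arr u))"
  define P where "P j = {t \<in> L. l - j < t}" for j
  \<comment> \<open>\<open>P j\<close> holds the labels tried so far. The cardinality clause is the
    one needed for \<open>free_neighbour_exists\<close>; it is an inequality because a failing pass
    enlarges \<open>P j\<close> but not the assignment. The last clause says that failure refutes
    \<open>H\<close>.\<close>
  define I where "I j r \<longleftrightarrow>
      (\<forall>u<n. r asg_arr u \<noteq> 0 \<longrightarrow> r asg_arr u \<in> P j \<and> r asg_arr u \<le> s cap_arr u) \<and>
      card {u. u < n \<and> r asg_arr u \<noteq> 0} \<le> card (P j) \<and>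
      (r ok_var 0 \<noteq> 0 \<longrightarrow> s ok_var 0 \<noteq> 0 \<and> P j \<subseteq> r asg_arr ` {..<n}) \<and>
      (s ok_var 0 \<noteq> 0 \<and> H \<longrightarrow> r ok_var 0 \<noteq> 0)" for j :: nat and r :: state
  have fin: "finite (P j)" for j by (simp add: P_def L_def)
  have In: "I n s'"
    unfolding s'_def
  proof (rule For_invariant[where I = I and s = s])
    have "P 0 = {}" by (auto simp: P_def L_def)
    then show "I 0 (put s j_var 0 0)" using asg by (auto simp: I_def)
  next
    fix j r
    assume "j < n" and rn: "r 0 0 = n" and rj: "r j_var 0 = j"
      and fr: "\<And>y. y \<notin> insert j_var (writes assign_label) \<Longrightarrow> r y = s y" and Ij: "I j r"
    have r: "r l_var 0 = l" "r i_var 0 = i" "r cap_arr = s cap_arr"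
      using l i by (simp_all add: fr)
    let ?r' = "put (sem assign_label r) j_var 0 (Suc j)"
    define t where "t = l - j"
    show "I (Suc j) ?r'"
    proof (cases "t = 0 \<or> t = i")
      case True
      then have "P (Suc j) = P j" by (auto simp: P_def L_def t_def)
      moreover have "?r' asg_arr = r asg_arr" "?r' ok_var = r ok_var"
        using True r rj by (auto simp: assign_label_def t_def)
      ultimately show ?thesis using Ij by (simp add: I_def)
    next
      case False
      have P: "P (Suc j) = insert t (P j)" "t \<notin> P j" "\<forall>x\<in>P j. t < x" "t \<in> L"
        using False by (auto simp: P_def L_def t_def)
      let ?q = "put r lbl_var 0 t"
      let ?w = "sem search_free ?q"
      have w: "?w asg_arr = r asg_arr" "?w ok_var = r ok_var" "?w lbl_var 0 = t"
        by (simp_all add: sem_frame)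
      have sem: "sem assign_label r =
          (if ?w wit_var 0 = 0 then put ?w ok_var 0 0
           else put ?w asg_arr (?w wit_var 0 - 1) t)"
        using False r rj w by (simp add: assign_label_def t_def)
      have "?q 0 0 = n" using rn by simp
      from search_free_correct[of ?q n, OF this] consider
          (none) "?w wit_var 0 = 0" "\<forall>u<n. r asg_arr u \<noteq> 0 \<or> s cap_arr u < t"
        | (some) u where "u < n" "?w wit_var 0 = Suc u" "r asg_arr u = 0" "t \<le> s cap_arr u"
        by (auto simp: r)
      then show ?thesis
      proof cases
        case none
        have "\<not> H"
        proof
          assume H
          then obtain g where g: "L \<subseteq> g ` {..<n}" "\<forall>u<n. g u \<le> s cap_arr u"
            by (auto simp: H_def)
          have "insert t (P j) \<subseteq> g ` {..<n}" using g(1) P(4) by (auto simp: P_def)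
          then have "\<exists>u<n. r asg_arr u = 0 \<and> t \<le> s cap_arr u"
            by (rule free_neighbour_exists[OF _ P(3) fin g(2)]) (use Ij in \<open>simp add: I_def\<close>)
          then show False using none(2) by (meson not_less)
        qed
        moreover have "?r' asg_arr = r asg_arr" "?r' ok_var 0 = 0"
          using none(1) w by (simp_all add: sem)
        ultimately show ?thesis using Ij P(2) fin by (auto simp: I_def P(1))
      next
        case (some u)
        have asg': "?r' asg_arr = (r asg_arr)(u := t)" and ok': "?r' ok_var = r ok_var"
          using some w by (simp_all add: sem fun_eq_iff)
        have "t \<noteq> 0" using False by simp
        have "{x. x < n \<and> ?r' asg_arr x \<noteq> 0} = insert u {x. x < n \<and> r asg_arr x \<noteq> 0}"
          using some \<open>t \<noteq> 0\<close> by (auto simp: asg')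
        then have card: "card {x. x < n \<and> ?r' asg_arr x \<noteq> 0} \<le> card (P (Suc j))"
          using some Ij P(2) fin by (simp add: I_def P(1))
        \<comment> \<open>Overwriting entry \<open>u\<close> loses no label: it held 0, and 0 is not
          in \<open>P j\<close>.\<close>
        have "insert t (P j) \<subseteq> ?r' asg_arr ` {..<n}" if "P j \<subseteq> r asg_arr ` {..<n}"
        proof -
          have "x \<in> ?r' asg_arr ` {..<n}" if x: "x \<in> P j" for x
          proof -
            obtain y where "y < n" "x = r asg_arr y" using x \<open>P j \<subseteq> _\<close> by blast
            moreover have "x \<noteq> 0" using x by (auto simp: P_def)
            ultimately show ?thesis using some by (intro image_eqI[of _ _ y]) (auto simp: asg')
          qed
          moreover have "t \<in> ?r' asg_arr ` {..<n}"
            using some by (intro image_eqI[of _ _ u]) (auto simp: asg')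
          ultimately show ?thesis by blast
        qed
        then show ?thesis using Ij some card unfolding I_def ok' P(1)
          by (auto simp: asg')
      qed
    qed
  qed (use n in simp_all)
  \<comment> \<open>Since \<open>l < n\<close>, the bound \<open>l - n\<close> is 0, so
    \<open>n\<close> passes reach every label.\<close>
  have Pn: "P n = L" using l by (auto simp: P_def L_def)
  have le: "s' asg_arr u \<le> s cap_arr u" if "u < n" for u
    using In that by (cases "s' asg_arr u = 0") (simp_all add: I_def)
  then show "\<forall>u<n. s' asg_arr u \<le> s cap_arr u" by simp
  show cov: "L \<subseteq> s' asg_arr ` {..<n}" if "s' ok_var 0 \<noteq> 0"
    using In that by (simp add: I_def Pn)
  have "s' ok_var 0 \<noteq> 0 \<Longrightarrow> s ok_var 0 \<noteq> 0" "s ok_var 0 \<noteq> 0 \<and> H \<Longrightarrow> s' ok_var 0 \<noteq> 0"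
    using In by (simp_all add: I_def)
  moreover have H if "s' ok_var 0 \<noteq> 0" using cov[OF that] le unfolding H_def by blast
  ultimately show "s' ok_var 0 \<noteq> 0 \<longleftrightarrow>
      s ok_var 0 \<noteq> 0 \<and> (\<exists>g. L \<subseteq> g ` {..<n} \<and> (\<forall>u<n. g u \<le> s cap_arr u))"
    unfolding H_def[symmetric] by blast
qed

section \<open>The greedy program as a feasibility test\<close>

context tree_dist
begin

definition input_ok :: "state \<Rightarrow> bool" where
  "input_ok s \<longleftrightarrow> s 0 0 = n \<and> (\<forall>u<n. \<forall>v<n. s 1 (u * n + v) \<noteq> 0 \<longleftrightarrow> E u v) \<and>
     (\<forall>x<n * n. s row_arr x = x * n)"

definition table :: "state \<Rightarrow> nat \<Rightarrow> nat \<Rightarrow> nat \<Rightarrow> nat" where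
  "table s v p i = s tab_arr ((v * n + p) * n + i)"

lemma index_less:
  assumes "u < n" "v < n"
  shows "u * n + v < n * n"
proof -
  have "u * n + v < Suc u * n" using assms by simp
  also have "\<dots> \<le> n * n" using assms by (intro mult_le_mono) auto
  finally show ?thesis .
qed

lemma aval_index2:
  "input_ok s \<Longrightarrow> aval a s < n \<Longrightarrow> aval (index2 a b) s = aval a s * n + aval b s"
  using less_le_trans[OF _ le_square, of "aval a s" n] by (simp add: index2_def input_ok_def)

lemma aval_index3:
  "input_ok s \<Longrightarrow> aval a s < n \<Longrightarrow> aval b s < n \<Longrightarrow>
    aval (index3 a b c) s = (aval a s * n + aval b s) * n + aval c s"
  using index_less[of "aval a s" "aval b s"]
  by (simp add: index3_def index2_def[of "index2 a b"] aval_index2) (simp add: input_ok_def)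

lemma load_caps_correct:
  assumes ok: "input_ok s" and v: "s v_var 0 = v" "v < n"
    and p: "s p_var 0 = p" and l: "s l_var 0 = l"
  shows "\<forall>u<n. sem load_caps s cap_arr u = caps (table s) v p l u"
    and "sem load_caps s ok_var 0 \<noteq> 0 \<longleftrightarrow> (\<forall>u\<in>others v p. table s u v l \<noteq> 0)"
proof -
  let ?p = "Store cap_arr (Var u_var) (N 0) ;;
       When (Cell 1 (index2 (Var v_var) (Var u_var)))
        (When (neq (Var u_var) (Var p_var))
          (Store cap_arr (Var u_var) (Cell tab_arr (index3 (Var u_var) (Var v_var) (Var l_var))) ;;
           When (is_zero (Cell cap_arr (Var u_var))) (Store ok_var (N 0) (N 0))))"
  let ?I = "\<lambda>k r. (\<forall>u<k. r cap_arr u = caps (table s) v p l u) \<and>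
      (r ok_var 0 \<noteq> 0 \<longleftrightarrow> (\<forall>u<k. u \<in> others v p \<longrightarrow> table s u v l \<noteq> 0))"
  let ?s = "put s ok_var 0 1"
  have "?I n (sem (For u_var ?p) ?s)"
  proof (rule For_invariant[where I = ?I and s = ?s])
    fix i r
    assume "i < n" "r 0 0 = n" and ri: "r u_var 0 = i" and I: "?I i r"
      and fr: "\<And>y. y \<notin> insert u_var (writes ?p) \<Longrightarrow> r y = ?s y"
    have r: "r v_var 0 = v" "r p_var 0 = p" "r l_var 0 = l" "r 1 = s 1" "r row_arr = s row_arr"
      "r tab_arr = s tab_arr" using v p l by (simp_all add: fr)
    define r1 where "r1 = put r cap_arr i 0"
    have r1: "r1 v_var 0 = v" "r1 p_var 0 = p" "r1 l_var 0 = l" "r1 u_var 0 = i"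
      "r1 1 = s 1" "r1 tab_arr = s tab_arr" "input_ok r1"
      using r ri ok \<open>r 0 0 = n\<close> by (simp_all add: r1_def input_ok_def)
    have ix: "aval (index2 (Var v_var) (Var u_var)) r1 = v * n + i"
      "aval (index3 (Var u_var) (Var v_var) (Var l_var)) r1 = (i * n + v) * n + l"
      using aval_index2[OF r1(7)] aval_index3[OF r1(7)] r1(1-4) v(2) \<open>i < n\<close> by simp_all
    have adj: "s 1 (v * n + i) \<noteq> 0 \<longleftrightarrow> E v i" using ok v(2) \<open>i < n\<close> by (auto simp: input_ok_def)
    have oth: "i \<in> others v p \<longleftrightarrow> E v i \<and> i \<noteq> p" by (simp add: others_def)
    have sem: "sem ?p r = (if i \<in> others v p then
        (if table s i v l = 0 then put (put r1 cap_arr i (table s i v l)) ok_var 0 0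
         else put r1 cap_arr i (table s i v l)) else r1)"
      using ri adj r1(1-6) by (simp add: ix oth table_def flip: r1_def)
    define q where "q = put (sem ?p r) u_var 0 (Suc i)"
    have q: "q cap_arr = (r cap_arr)(i := caps (table s) v p l i)"
      "q ok_var 0 = (if i \<in> others v p \<and> table s i v l = 0 then 0 else r ok_var 0)"
      unfolding q_def sem by (simp_all add: fun_eq_iff caps_def r1_def)
    show "?I (Suc i) (put (sem ?p r) u_var 0 (Suc i))"
      using I unfolding q_def[symmetric] by (simp add: q less_Suc_eq all_conj_distrib)
  qed (use ok in \<open>simp_all add: input_ok_def\<close>)
  moreover have "u < n" if "u \<in> others v p" for u using that E_less by (auto simp: others_def)
  ultimately show "\<forall>u<n. sem load_caps s cap_arr u = caps (table s) v p l u"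
    and "sem load_caps s ok_var 0 \<noteq> 0 \<longleftrightarrow> (\<forall>u\<in>others v p. table s u v l \<noteq> 0)"
    by (auto simp: load_caps_def)
qed

lemma clear_correct:
  assumes "s 0 0 = n"
  shows "\<forall>u<n. sem (For u_var (Store asg_arr (Var u_var) (N 0))) s asg_arr u = 0"
  by (rule For_invariant[where I = "\<lambda>k r. \<forall>u<k. r asg_arr u = 0" and s = s])
    (use assms in \<open>auto simp: less_Suc_eq\<close>)

text \<open>The first conclusion serves the table computation. The other two expose the assignment
  itself, because spreading the labels reruns the same program and uses its result.\<close>

lemma greedy_correct:
  assumes ok: "input_ok s" and v: "s v_var 0 = v" "v < n"
    and p: "s p_var 0 = p" and l: "s l_var 0 = l" "1 \<le> l" "l < n" and i: "s i_var 0 = i"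
    and tab: "\<forall>u\<in>others v p. table_ok (table s) u v l"
  defines "s' \<equiv> sem greedy s"
  shows "s' ok_var 0 \<noteq> 0 \<longleftrightarrow> feasible v p l i"
    and "feasible v p l i \<Longrightarrow> \<forall>u\<in>others v p. feasible u v (max 1 (s' asg_arr u)) l"
    and "feasible v p l i \<Longrightarrow> {1..l} \<subseteq> insert i ((\<lambda>u. max 1 (s' asg_arr u)) ` others v p)"
proof -
  let ?c = "For u_var (Store asg_arr (Var u_var) (N 0))"
  define s1 where "s1 = sem load_caps s"
  define s2 where "s2 = sem ?c s1"
  have s': "s' = sem (For j_var assign_label) s2" by (simp add: s'_def s2_def s1_def greedy_def)
  have n: "s 0 0 = n" using ok by (simp add: input_ok_def)
  have s1: "s1 0 = s 0" "s1 l_var = s l_var" "s1 i_var = s i_var"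
    by (simp_all add: s1_def sem_frame)
  have s2: "s2 0 = s1 0" "s2 l_var = s1 l_var" "s2 i_var = s1 i_var" "s2 cap_arr = s1 cap_arr"
    "s2 ok_var = s1 ok_var"
    unfolding s2_def by (intro sem_frame; simp)+
  have caps: "\<forall>u<n. s2 cap_arr u = caps (table s) v p l u"
    using load_caps_correct(1)[OF ok v p l(1)] by (simp add: s2 s1_def)
  have pos: "s2 ok_var 0 \<noteq> 0 \<longleftrightarrow> (\<forall>u\<in>others v p. table s u v l \<noteq> 0)"
    using load_caps_correct(2)[OF ok v p l(1)] by (simp add: s2 s1_def)
  have clear: "\<forall>u<n. s2 asg_arr u = 0" unfolding s2_def by (rule clear_correct) (simp add: s1 n)
  note asg = assign_labels_correct[where s = s2 and n = n and l = l and i = i, OF _ _ l(3) _ clear refl,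
      folded s', unfolded s2 s1, OF n l(1) i, folded s2(4,5)]
  have le: "\<forall>u<n. s' asg_arr u \<le> caps (table s) v p l u" using asg(1) caps by simp
  show eq: "s' ok_var 0 \<noteq> 0 \<longleftrightarrow> feasible v p l i"
  proof
    assume ok': "s' ok_var 0 \<noteq> 0"
    show "feasible v p l i"
      by (rule feasible_of_assignment(3)[OF l(2,3) tab _ asg(3)[OF ok'] le])
        (use asg(2) ok' pos in blast)
  next
    assume f: "feasible v p l i"
    obtain g where "{1..l} - {i} \<subseteq> g ` {..<n}" "\<forall>u<n. g u \<le> s2 cap_arr u"
      using assignment_of_feasible(2)[OF f tab] caps by auto
    then show "s' ok_var 0 \<noteq> 0"
      unfolding asg(2) using pos assignment_of_feasible(1)[OF f tab] by blast
  qed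
  assume f: "feasible v p l i"
  then have cov: "{1..l} - {i} \<subseteq> s' asg_arr ` {..<n}"
    and pos: "\<forall>u\<in>others v p. table s u v l \<noteq> 0"
    using eq asg(3) assignment_of_feasible(1)[OF f tab] by blast+
  show "\<forall>u\<in>others v p. feasible u v (max 1 (s' asg_arr u)) l"
    by (rule feasible_of_assignment(1)[OF l(2,3) tab pos cov le])
  show "{1..l} \<subseteq> insert i ((\<lambda>u. max 1 (s' asg_arr u)) ` others v p)"
    by (rule feasible_of_assignment(2)[OF l(2,3) tab pos cov le])
qed

end

section \<open>Computing the table of largest feasible labels\<close>

abbreviation (input) "round_var \<equiv> 17 :: nat"
abbreviation (input) "best_var \<equiv> 18 :: nat"
abbreviation (input) "count_var \<equiv> 23 :: nat"
abbreviation (input) "product_var \<equiv> 24 :: nat"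

definition push_row :: prog where
  "push_row =
     Store row_arr (Var count_var) (Var product_var) ;;
     Store count_var (N 0) (Plus (Var count_var) (N 1)) ;;
     Store product_var (N 0) (Plus (Var product_var) (Var 0))"

text \<open>The two loops only serve to run \<open>push_row\<close> \<open>n * n\<close> times; the
  multiples arise by repeated addition of array 0.\<close>

definition fill_rows :: prog where
  "fill_rows =
     Store count_var (N 0) (N 0) ;;
     Store product_var (N 0) (N 0) ;;
     For v_var (For p_var push_row)"

text \<open>The last success is the largest feasible label. The pass for label 0 is harmless:
  whatever \<open>greedy\<close> reports, \<open>best_var\<close> is 0 afterwards.\<close>

definition fill_entry :: prog where
  "fill_entry =
     Store best_var (N 0) (N 0) ;;
     For l_var (greedy ;; When (Var ok_var) (Store best_var (N 0) (Var l_var))) ;;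
     Store tab_arr (index3 (Var v_var) (Var p_var) (Var i_var)) (Var best_var)"

definition fill_table :: prog where
  "fill_table = For round_var (For v_var (For p_var (For i_var fill_entry)))"

lemma writes_fill [simp]:
  "writes push_row = {row_arr, count_var, product_var}"
  "writes fill_rows = {row_arr, count_var, product_var, v_var, p_var}"
  "writes fill_entry =
    {tab_arr, cap_arr, asg_arr, ok_var, wit_var, lbl_var, u_var, j_var, l_var, best_var}"
  "writes fill_table =
    {tab_arr, cap_arr, asg_arr, ok_var, wit_var, lbl_var, u_var, j_var, l_var, best_var,
     i_var, p_var, v_var, round_var}"
  by (auto simp: push_row_def fill_rows_def fill_entry_def fill_table_def)

lemma wf_fill [simp]:
  "wf_prog push_row" "wf_prog fill_rows" "wf_prog fill_entry" "wf_prog fill_table"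
  by (simp_all add: push_row_def fill_rows_def fill_entry_def fill_table_def)

lemma fill_rows_correct:
  assumes n: "s 0 0 = n"
  shows "\<forall>x<n * n. sem fill_rows s row_arr x = x * n"
proof -
  define K where "K k r \<longleftrightarrow> r count_var 0 = k \<and> r product_var 0 = k * n \<and>
      (\<forall>x<k. r row_arr x = x * n)" for k and r :: state
  let ?s = "put (put s count_var 0 0) product_var 0 0"
  have "K (n * n) (sem (For v_var (For p_var push_row)) ?s)"
  proof (rule For_invariant[where I = "\<lambda>a. K (a * n)" and s = ?s])
    show "K (0 * n) (put ?s v_var 0 0)" by (simp add: K_def)
  next
    fix a r assume "r 0 0 = n" "K (a * n) r"
    have "K (a * n + n) (sem (For p_var push_row) r)"
    proof (rule For_invariant[where I = "\<lambda>b. K (a * n + b)" and s = r])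
      show "K (a * n + 0) (put r p_var 0 0)" using \<open>K (a * n) r\<close> by (simp add: K_def)
    next
      fix b q assume "q 0 0 = n" "K (a * n + b) q"
      then show "K (a * n + Suc b) (put (sem push_row q) p_var 0 (Suc b))"
        by (simp add: K_def push_row_def less_Suc_eq algebra_simps)
    qed (use \<open>r 0 0 = n\<close> in simp_all)
    then show "K (Suc a * n) (put (sem (For p_var push_row) r) v_var 0 (Suc a))"
      by (simp add: K_def add.commute)
  qed (use n in simp_all)
  then show ?thesis by (simp add: K_def fill_rows_def)
qed

section \<open>Convergence of the sweeps\<close>

context tree_dist
begin

lemma input_ok_cong:
  "r 0 = s 0 \<Longrightarrow> r 1 = s 1 \<Longrightarrow> r row_arr = s row_arr \<Longrightarrow> input_ok r \<longleftrightarrow> input_ok s"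
  by (simp add: input_ok_def)

lemma table_cong: "r tab_arr = s tab_arr \<Longrightarrow> table r = table s"
  by (simp add: table_def fun_eq_iff)

lemma index3_inject:
  assumes "p < n" "i < n" "p' < n" "i' < n"
  shows "(v * n + p) * n + i = (v' * n + p') * n + i' \<longleftrightarrow> v = v' \<and> p = p' \<and> i = i'"
proof
  assume eq: "(v * n + p) * n + i = (v' * n + p') * n + i'"
  have "((v * n + p) * n + i) mod n = i" "((v' * n + p') * n + i') mod n = i'"
    using assms by simp_all
  moreover have "((v * n + p) * n + i) div n = v * n + p"
      "((v' * n + p') * n + i') div n = v' * n + p'"
    using assms by simp_all
  moreover have "(v * n + p) mod n = p" "(v' * n + p') mod n = p'" "(v * n + p) div n = v"
      "(v' * n + p') div n = v'"
    using assms by simp_all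
  ultimately show "v = v' \<and> p = p' \<and> i = i'" using eq by metis
qed simp

lemma fill_entry_table:
  assumes ok: "input_ok s" and v: "s v_var 0 = v" "v < n" and p: "s p_var 0 = p" "p < n"
    and i: "s i_var 0 = i" "i < n"
    and "v' < n" "p' < n" "i' < n" "(v', p', i') \<noteq> (v, p, i)"
  shows "table (sem fill_entry s) v' p' i' = table s v' p' i'"
proof -
  let ?p = "For l_var (greedy ;; When (Var ok_var) (Store best_var (N 0) (Var l_var)))"
  let ?s = "put s best_var 0 0"
  define q where "q = sem ?p ?s"
  have q: "q 0 = s 0" "q 1 = s 1" "q row_arr = s row_arr" "q tab_arr = s tab_arr"
      "q v_var = s v_var" "q p_var = s p_var" "q i_var = s i_var"
    unfolding q_def by (subst sem_frame; simp)+
  have "input_ok q" using ok input_ok_cong q by blast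
  then have "aval (index3 (Var v_var) (Var p_var) (Var i_var)) q = (v * n + p) * n + i"
    using aval_index3 q v p i by simp
  then have "sem fill_entry s = put q tab_arr ((v * n + p) * n + i) (q best_var 0)"
    by (simp add: fill_entry_def q_def)
  moreover have "(v' * n + p') * n + i' \<noteq> (v * n + p) * n + i"
    using assms index3_inject[of p' i' p i v' v] by blast
  ultimately show ?thesis using q(4) by (simp add: table_def)
qed

lemma fill_entry_table_ok:
  assumes ok: "input_ok s" and v: "s v_var 0 = v" "v < n" and p: "s p_var 0 = p" "p < n"
    and i: "s i_var 0 = i" "i < n"
    and tab: "\<forall>u\<in>others v p. \<forall>l<n. table_ok (table s) u v l"
  shows "table_ok (table (sem fill_entry s)) v p i"
proof -
  let ?b = "greedy ;; When (Var ok_var) (Store best_var (N 0) (Var l_var))"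
  let ?s = "put s best_var 0 0"
  define q where "q = sem (For l_var ?b) ?s"
  define K where "K k r \<longleftrightarrow> (\<forall>x. feasible v p x i \<and> x < k \<longleftrightarrow> 1 \<le> x \<and> x \<le> r best_var 0)"
    for k and r :: state
  have "K n q"
    unfolding q_def
  proof (rule For_invariant[where I = K and s = ?s])
    fix l r
    assume "l < n" "r 0 0 = n" and rl: "r l_var 0 = l" and K: "K l r"
      and fr: "\<And>y. y \<notin> insert l_var (writes ?b) \<Longrightarrow> r y = ?s y"
    have r: "r 0 = s 0" "r 1 = s 1" "r row_arr = s row_arr" "r tab_arr = s tab_arr"
        "r v_var 0 = v" "r p_var 0 = p" "r i_var 0 = i"
      using v p i by (simp_all add: fr)
    let ?g = "sem greedy r"
    have g: "?g best_var = r best_var" "?g l_var 0 = l" using rl by (simp_all add: sem_frame)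
    have best: "put (sem ?b r) l_var 0 (Suc l) best_var 0 =
        (if ?g ok_var 0 \<noteq> 0 then l else r best_var 0)"
      using g by simp
    have rok: "input_ok r" using ok input_ok_cong r by blast
    have rtab: "\<forall>u\<in>others v p. table_ok (table r) u v l"
      using tab \<open>l < n\<close> table_cong[of r s, OF r(4)] by simp
    show "K (Suc l) (put (sem ?b r) l_var 0 (Suc l))"
    proof (cases "l = 0")
      case True
      have "r best_var 0 = 0"
        using K True unfolding K_def by (metis not_less_zero le_refl less_one not_le)
      then have "put (sem ?b r) l_var 0 (Suc l) best_var 0 = 0" using True best by simp
      moreover have "\<not> feasible v p 0 i" by (simp add: feasible_iff[of v])
      ultimately show ?thesis unfolding K_def using True by (auto simp: less_Suc_eq)
    next
      case False
      have "?g ok_var 0 \<noteq> 0 \<longleftrightarrow> feasible v p l i"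
        using greedy_correct(1)[OF rok r(5) v(2) r(6) rl _ \<open>l < n\<close> r(7) rtab] False by simp
      then have eq: "put (sem ?b r) l_var 0 (Suc l) best_var 0 =
          (if feasible v p l i then l else r best_var 0)" using best by simp
      show ?thesis
      proof (cases "feasible v p l i")
        case True
        \<comment> \<open>By downward closure, success at \<open>l\<close> determines the whole
          segment from 1 to \<open>l\<close>.\<close>
        then have "feasible v p x i" if "1 \<le> x" "x \<le> l" for x
          using that feasible_downward by blast
        moreover have "1 \<le> x" if "feasible v p x i" for x
          using that by (simp add: feasible_iff[of v])
        ultimately show ?thesis using True unfolding K_def eq by auto
      next
        case False
        then have "feasible v p x i \<and> x < Suc l \<longleftrightarrow> feasible v p x i \<and> x < l" for x
          by (cases "x = l") auto
        then show ?thesis using K False unfolding K_def eq by simp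
      qed
    qed
  qed (use ok in \<open>auto simp: K_def input_ok_def\<close>)
  have q: "q 0 = s 0" "q 1 = s 1" "q row_arr = s row_arr"
      "q v_var = s v_var" "q p_var = s p_var" "q i_var = s i_var"
    unfolding q_def by (subst sem_frame; simp)+
  have "input_ok q" using ok input_ok_cong q by blast
  then have "aval (index3 (Var v_var) (Var p_var) (Var i_var)) q = (v * n + p) * n + i"
    using aval_index3 q v p i by simp
  then have "sem fill_entry s = put q tab_arr ((v * n + p) * n + i) (q best_var 0)"
    by (simp add: fill_entry_def q_def)
  then have "table (sem fill_entry s) v p i = q best_var 0" by (simp add: table_def)
  moreover have "feasible v p x i \<and> x < n \<longleftrightarrow> feasible v p x i" for x
    using feasible_iff[of v p x i] by blast
  ultimately show ?thesis using \<open>K n q\<close> by (simp add: K_def table_ok_def)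
qed

text \<open>The measure of progress: an entry depends only on strictly smaller branches, so a sweep
  in any order raises \<open>k\<close> by one.\<close>

definition settled :: "nat \<Rightarrow> state \<Rightarrow> bool" where
  "settled k s \<longleftrightarrow>
    (\<forall>v<n. \<forall>p<n. \<forall>i<n. branch_size v p \<le> k \<longrightarrow> table_ok (table s) v p i)"

lemma fill_entry_progress:
  assumes ok: "input_ok s" and v: "s v_var 0 = v" "v < n" and p: "s p_var 0 = p" "p < n"
    and i: "s i_var 0 = i" "i < n"
    and set: "settled k s" and size: "branch_size v p \<le> Suc k"
  shows "table_ok (table (sem fill_entry s)) v p i"
proof (rule fill_entry_table_ok[OF ok v p i])
  show "\<forall>u\<in>others v p. \<forall>l<n. table_ok (table s) u v l"
  proof (intro ballI allI impI)
    fix u l assume u: "u \<in> others v p" and l: "l < n"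
    have "u < n" using u E_less by (auto simp: others_def)
    moreover have "branch_size u v \<le> k"
      using branch_size_decreasing[of v u p] u size by (simp add: others_def)
    ultimately show "table_ok (table s) u v l" using set l v by (simp add: settled_def)
  qed
qed

lemma table_ok_cong:
  "table r v p i = table s v p i \<Longrightarrow> table_ok (table r) v p i = table_ok (table s) v p i"
  by (simp add: table_ok_def)

text \<open>This and the next two lemmas climb the loop nest with the same triple: settled entries
  stay correct, entries of other indices are untouched, and the loop's own entries become correct.
  The middle part protects what the same sweep has already achieved.\<close>

lemma fill_i_loop:
  assumes ok: "input_ok s" and v: "s v_var 0 = v" "v < n" and p: "s p_var 0 = p" "p < n"
    and set: "settled k s"
  defines "s' \<equiv> sem (For i_var fill_entry) s"
  shows "settled k s'"
    and "\<forall>v'<n. \<forall>p'<n. \<forall>i'<n. (v', p') \<noteq> (v, p) \<longrightarrow> table s' v' p' i' = table s v' p' i'"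
    and "branch_size v p \<le> Suc k \<longrightarrow> (\<forall>i<n. table_ok (table s') v p i)"
proof -
  let ?J = "\<lambda>r. settled k r \<and>
    (\<forall>v'<n. \<forall>p'<n. \<forall>i'<n. (v', p') \<noteq> (v, p) \<longrightarrow> table r v' p' i' = table s v' p' i')"
  let ?Q = "\<lambda>i r. branch_size v p \<le> Suc k \<longrightarrow> table_ok (table r) v p i"
  have tp: "table (put r i_var a b) = table r" for r a b by (rule table_cong) simp
  have sp: "settled k (put r i_var a b) = settled k r" for r a b by (simp add: settled_def tp)
  have "?J s' \<and> (\<forall>i<n. ?Q i s')"
    unfolding s'_def
  proof (rule For_each[where J = ?J and Q = ?Q and s = s])
    show "s 0 0 = n" using ok by (simp add: input_ok_def)
    show "?J (put s i_var 0 0)" using set by (simp add: tp sp)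
  next
    fix i r
    assume i: "i < n" and ri: "r i_var 0 = i" and J: "?J r"
      and fr: "\<And>y. y \<notin> insert i_var (writes fill_entry) \<Longrightarrow> r y = s y"
    have r: "r 0 = s 0" "r 1 = s 1" "r row_arr = s row_arr" "r v_var 0 = v" "r p_var 0 = p"
      using v p by (simp_all add: fr)
    have rok: "input_ok r" using ok input_ok_cong r by blast
    note same = fill_entry_table[OF rok r(4) v(2) r(5) p(2) ri i]
    note prog = fill_entry_progress[OF rok r(4) v(2) r(5) p(2) ri i]
    have "settled k (sem fill_entry r)"
      unfolding settled_def
    proof (intro allI impI)
      fix v' p' i' assume a: "v' < n" "p' < n" "i' < n" "branch_size v' p' \<le> k"
      show "table_ok (table (sem fill_entry r)) v' p' i'"
      proof (cases "(v', p', i') = (v, p, i)")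
        \<comment> \<open>A settled entry is recomputed; its size is at most \<open>k\<close>, so
          the result is correct again.\<close>
        case True
        then show ?thesis using prog[of k] J a by simp
      next
        case False
        have "table_ok (table r) v' p' i'" using J a by (simp add: settled_def)
        then show ?thesis using table_ok_cong[OF same[OF a(1-3) False]] by simp
      qed
    qed
    moreover have "\<forall>v'<n. \<forall>p'<n. \<forall>i'<n. (v', p') \<noteq> (v, p) \<longrightarrow>
        table (sem fill_entry r) v' p' i' = table s v' p' i'"
      using same J by auto
    moreover have "?Q i (sem fill_entry r)" using prog[of k] J by simp
    moreover have "?Q j (sem fill_entry r)" if "j < i" "?Q j r" for j
      using that table_ok_cong[OF same[of v p j]] v p i by simp
    ultimately show "?J (put (sem fill_entry r) i_var 0 (Suc i)) \<and>
        ?Q i (put (sem fill_entry r) i_var 0 (Suc i)) \<and>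
        (\<forall>j<i. ?Q j r \<longrightarrow> ?Q j (put (sem fill_entry r) i_var 0 (Suc i)))"
      unfolding tp sp by blast
  qed simp
  then show "settled k s'"
    and "\<forall>v'<n. \<forall>p'<n. \<forall>i'<n. (v', p') \<noteq> (v, p) \<longrightarrow> table s' v' p' i' = table s v' p' i'"
    and "branch_size v p \<le> Suc k \<longrightarrow> (\<forall>i<n. table_ok (table s') v p i)"
    by blast+
qed

lemma fill_p_loop:
  assumes ok: "input_ok s" and v: "s v_var 0 = v" "v < n" and set: "settled k s"
  defines "s' \<equiv> sem (For p_var (For i_var fill_entry)) s"
  shows "settled k s'"
    and "\<forall>v'<n. \<forall>p'<n. \<forall>i'<n. v' \<noteq> v \<longrightarrow> table s' v' p' i' = table s v' p' i'"
    and "\<forall>p<n. branch_size v p \<le> Suc k \<longrightarrow> (\<forall>i<n. table_ok (table s') v p i)"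
proof -
  let ?b = "For i_var fill_entry"
  let ?J = "\<lambda>r. settled k r \<and>
    (\<forall>v'<n. \<forall>p'<n. \<forall>i'<n. v' \<noteq> v \<longrightarrow> table r v' p' i' = table s v' p' i')"
  let ?Q = "\<lambda>p r. branch_size v p \<le> Suc k \<longrightarrow> (\<forall>i<n. table_ok (table r) v p i)"
  have tp: "table (put r p_var a b) = table r" for r a b by (rule table_cong) simp
  have sp: "settled k (put r p_var a b) = settled k r" for r a b by (simp add: settled_def tp)
  have "?J s' \<and> (\<forall>p<n. ?Q p s')"
    unfolding s'_def
  proof (rule For_each[where J = ?J and Q = ?Q and s = s])
    show "s 0 0 = n" using ok by (simp add: input_ok_def)
    show "?J (put s p_var 0 0)" using set by (simp add: tp sp)
  next
    fix p r
    assume p: "p < n" and rp: "r p_var 0 = p" and J: "?J r"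
      and fr: "\<And>y. y \<notin> insert p_var (writes ?b) \<Longrightarrow> r y = s y"
    have r: "r 0 = s 0" "r 1 = s 1" "r row_arr = s row_arr" "r v_var 0 = v"
      using v by (simp_all add: fr)
    have rok: "input_ok r" using ok input_ok_cong r by blast
    note loop = fill_i_loop[OF rok r(4) v(2) rp p conjunct1[OF J]]
    have "\<forall>v'<n. \<forall>p'<n. \<forall>i'<n. v' \<noteq> v \<longrightarrow> table (sem ?b r) v' p' i' = table s v' p' i'"
      using loop(2) J by auto
    moreover have "?Q j (sem ?b r)" if "j < p" "?Q j r" for j
    proof (intro impI allI)
      fix i assume "branch_size v j \<le> Suc k" "i < n"
      then have "table_ok (table r) v j i" using that by blast
      moreover have "table (sem ?b r) v j i = table r v j i"
        using loop(2) v p that \<open>i < n\<close> by auto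
      ultimately show "table_ok (table (sem ?b r)) v j i" using table_ok_cong by blast
    qed
    ultimately show "?J (put (sem ?b r) p_var 0 (Suc p)) \<and>
        ?Q p (put (sem ?b r) p_var 0 (Suc p)) \<and>
        (\<forall>j<p. ?Q j r \<longrightarrow> ?Q j (put (sem ?b r) p_var 0 (Suc p)))"
      unfolding tp sp using loop(1,3) by blast
  qed simp
  then show "settled k s'"
    and "\<forall>v'<n. \<forall>p'<n. \<forall>i'<n. v' \<noteq> v \<longrightarrow> table s' v' p' i' = table s v' p' i'"
    and "\<forall>p<n. branch_size v p \<le> Suc k \<longrightarrow> (\<forall>i<n. table_ok (table s') v p i)"
    by blast+
qed

lemma fill_v_loop:
  assumes ok: "input_ok s" and set: "settled k s"
  shows "settled (Suc k) (sem (For v_var (For p_var (For i_var fill_entry))) s)"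
proof -
  let ?b = "For p_var (For i_var fill_entry)"
  let ?Q = "\<lambda>v r. \<forall>p<n. branch_size v p \<le> Suc k \<longrightarrow> (\<forall>i<n. table_ok (table r) v p i)"
  have tp: "table (put r v_var a b) = table r" for r a b by (rule table_cong) simp
  have sp: "settled k (put r v_var a b) = settled k r" for r a b by (simp add: settled_def tp)
  have "settled k (sem (For v_var ?b) s) \<and> (\<forall>v<n. ?Q v (sem (For v_var ?b) s))"
  proof (rule For_each[where J = "settled k" and Q = ?Q and s = s])
    show "s 0 0 = n" using ok by (simp add: input_ok_def)
    show "settled k (put s v_var 0 0)" using set by (simp add: sp)
  next
    fix v r
    assume v: "v < n" and rv: "r v_var 0 = v" and J: "settled k r"
      and fr: "\<And>y. y \<notin> insert v_var (writes ?b) \<Longrightarrow> r y = s y"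
    have r: "r 0 = s 0" "r 1 = s 1" "r row_arr = s row_arr" by (simp_all add: fr)
    have rok: "input_ok r" using ok input_ok_cong r by blast
    note loop = fill_p_loop[OF rok rv v J]
    have "?Q j (sem ?b r)" if "j < v" "?Q j r" for j
    proof (intro impI allI)
      fix p i assume "p < n" "branch_size j p \<le> Suc k" "i < n"
      then have "table_ok (table r) j p i" using that by blast
      moreover have "table (sem ?b r) j p i = table r j p i"
        using loop(2) v that \<open>p < n\<close> \<open>i < n\<close> by auto
      ultimately show "table_ok (table (sem ?b r)) j p i" using table_ok_cong by blast
    qed
    then show "settled k (put (sem ?b r) v_var 0 (Suc v)) \<and>
        ?Q v (put (sem ?b r) v_var 0 (Suc v)) \<and>
        (\<forall>j<v. ?Q j r \<longrightarrow> ?Q j (put (sem ?b r) v_var 0 (Suc v)))"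
      unfolding tp sp using loop(1,3) by blast
  qed simp
  then show ?thesis unfolding settled_def by blast
qed

text \<open>\<open>settled 0\<close> is vacuous, as every branch contains its own top vertex; after
  \<open>n\<close> rounds all entries are covered, as no branch has more than \<open>n\<close>
  vertices.\<close>

lemma fill_table_correct:
  assumes ok: "input_ok s"
  shows "\<forall>v<n. \<forall>p<n. \<forall>i<n. table_ok (table (sem fill_table s)) v p i"
proof -
  let ?b = "For v_var (For p_var (For i_var fill_entry))"
  have tp: "table (put r round_var a b) = table r" for r a b by (rule table_cong) simp
  have sp: "settled k (put r round_var a b) = settled k r" for k r a b
    by (simp add: settled_def tp)
  have "settled n (sem (For round_var ?b) s)"
  proof (rule For_invariant[where I = settled and s = s])
    show "s 0 0 = n" using ok by (simp add: input_ok_def)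
    have "branch_size v p \<noteq> 0" if "v < n" for v p
    proof (cases "E v p")
      case True
      have "d v v < d p v"
        using True that d_zero[of v v] d_zero[of p v] E_less[OF True] E_irrefl by (metis neq0_conv)
      then have "{w. w < n \<and> d v w < d p w} \<noteq> {}" using that by blast
      then show ?thesis using True by (simp add: branch_size_def)
    qed (use that in \<open>simp add: branch_size_def\<close>)
    then show "settled 0 (put s round_var 0 0)" unfolding settled_def le_zero_eq by blast
  next
    fix k r
    assume set: "settled k r" and fr: "\<And>y. y \<notin> insert round_var (writes ?b) \<Longrightarrow> r y = s y"
    have "r 0 = s 0" "r 1 = s 1" "r row_arr = s row_arr" by (simp_all add: fr)
    then have "input_ok r" using ok input_ok_cong by blast
    then show "settled (Suc k) (put (sem ?b r) round_var 0 (Suc k))"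
      using fill_v_loop[OF _ set] by (simp only: sp)
  qed simp
  then show ?thesis unfolding settled_def fill_table_def using branch_size_le by blast
qed

end

section \<open>Reading off an optimal labelling\<close>

abbreviation (input) "order_var \<equiv> 2 :: nat"
abbreviation (input) "class_arr \<equiv> 3 :: nat"
abbreviation (input) "root_var \<equiv> 19 :: nat"
abbreviation (input) "level_arr \<equiv> 20 :: nat"
abbreviation (input) "parent_arr \<equiv> 21 :: nat"
abbreviation (input) "parent_class_arr \<equiv> 22 :: nat"

definition find_root :: prog where
  "find_root =
     Store order_var (N 0) (N 0) ;;
     Store root_var (N 0) (N 0) ;;
     For v_var
      (When (Minus (Cell tab_arr (index3 (Var v_var) (Var v_var) (N 0))) (Var order_var))
        (Store order_var (N 0) (Cell tab_arr (index3 (Var v_var) (Var v_var) (N 0))) ;;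
         Store root_var (N 0) (Var v_var)))"

text \<open>The class is \<open>max 1\<close> of the assigned label, written with truncated
  subtraction. Level 0 means unreached and the root has level 1, so children of the layer handled in
  a round get the round number plus 2.\<close>

definition set_child :: prog where
  "set_child =
     Store class_arr (Var u_var)
       (Plus (Cell asg_arr (Var u_var)) (Minus (N 1) (Cell asg_arr (Var u_var)))) ;;
     Store level_arr (Var u_var) (Plus (Var round_var) (N 2)) ;;
     Store parent_arr (Var u_var) (Var v_var) ;;
     Store parent_class_arr (Var u_var) (Var l_var)"

definition expand :: prog where
  "expand =
     Store p_var (N 0) (Cell parent_arr (Var v_var)) ;;
     Store l_var (N 0) (Cell class_arr (Var v_var)) ;;
     Store i_var (N 0) (Cell parent_class_arr (Var v_var)) ;;
     greedy ;;
     For u_var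
      (When (Cell 1 (index2 (Var v_var) (Var u_var)))
        (When (neq (Var u_var) (Var p_var)) set_child))"

text \<open>A root that is its own parent, with parent class 0, is the encoding of the whole tree in
  \<open>feasible\<close>.\<close>

definition init_root :: prog where
  "init_root =
     Store class_arr (Var root_var) (Var order_var) ;;
     Store level_arr (Var root_var) (N 1) ;;
     Store parent_arr (Var root_var) (Var root_var) ;;
     Store parent_class_arr (Var root_var) (N 0)"

definition spread :: prog where
  "spread =
     For round_var
      (For v_var
        (When (is_zero (neq (Cell level_arr (Var v_var)) (Plus (Var round_var) (N 1)))) expand))"

definition solve :: prog where
  "solve = fill_rows ;; fill_table ;; find_root ;; init_root ;; spread"

lemma writes_solve [simp]:
  "writes find_root = {order_var, root_var, v_var}"
  "writes set_child = {class_arr, level_arr, parent_arr, parent_class_arr}"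
  "writes expand = {class_arr, level_arr, parent_arr, parent_class_arr, p_var, l_var, i_var,
    cap_arr, asg_arr, ok_var, wit_var, lbl_var, u_var, j_var}"
  "writes init_root = {class_arr, level_arr, parent_arr, parent_class_arr}"
  "writes spread = {class_arr, level_arr, parent_arr, parent_class_arr, p_var, l_var, i_var,
    cap_arr, asg_arr, ok_var, wit_var, lbl_var, u_var, j_var, v_var, round_var}"
  by (auto simp: find_root_def set_child_def expand_def init_root_def spread_def)

lemma wf_solve [simp]:
  "wf_prog find_root" "wf_prog set_child" "wf_prog expand" "wf_prog init_root" "wf_prog spread"
  "wf_prog solve"
  by (simp_all add: find_root_def set_child_def expand_def init_root_def spread_def solve_def)

context tree_dist
begin

lemma find_root_correct:
  assumes ok: "input_ok s"
  defines "s' \<equiv> sem find_root s"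
  shows "\<forall>v<n. table s v v 0 \<le> s' order_var 0"
    and "s' order_var 0 \<noteq> 0 \<Longrightarrow>
      s' root_var 0 < n \<and> table s (s' root_var 0) (s' root_var 0) 0 = s' order_var 0"
proof -
  let ?e = "Cell tab_arr (index3 (Var v_var) (Var v_var) (N 0))"
  let ?p = "When (Minus ?e (Var order_var))
      (Store order_var (N 0) ?e ;; Store root_var (N 0) (Var v_var))"
  let ?s = "put (put s order_var 0 0) root_var 0 0"
  let ?I = "\<lambda>k r. (\<forall>v<k. table s v v 0 \<le> r order_var 0) \<and> (r order_var 0 \<noteq> 0 \<longrightarrow>
      r root_var 0 < n \<and> table s (r root_var 0) (r root_var 0) 0 = r order_var 0)"
  have "?I n (sem (For v_var ?p) ?s)"
  proof (rule For_invariant[where I = ?I and s = ?s])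
    fix v r
    assume v: "v < n" "r v_var 0 = v" and I: "?I v r"
      and fr: "\<And>y. y \<notin> insert v_var (writes ?p) \<Longrightarrow> r y = ?s y"
    have r: "r 0 = s 0" "r 1 = s 1" "r row_arr = s row_arr" "r tab_arr = s tab_arr"
      by (simp_all add: fr)
    have "input_ok r" using ok input_ok_cong r by blast
    then have e: "aval ?e r = table s v v 0" using aval_index3 v r(4) by (simp add: table_def)
    define q where "q = put (sem ?p r) v_var 0 (Suc v)"
    have q: "q order_var 0 = max (r order_var 0) (table s v v 0)"
      "q root_var 0 = (if r order_var 0 < table s v v 0 then v else r root_var 0)"
      using e v(2) by (auto simp: q_def)
    have "table s x x 0 \<le> q order_var 0" if "x < Suc v" for x
      using I that by (cases "x = v") (auto simp: q le_max_iff_disj)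
    moreover have "q root_var 0 < n \<and> table s (q root_var 0) (q root_var 0) 0 = q order_var 0"
      if "q order_var 0 \<noteq> 0"
    proof (cases "r order_var 0 < table s v v 0")
      case True
      then show ?thesis using v by (simp add: q)
    next
      case False
      then have "q order_var 0 = r order_var 0" "q root_var 0 = r root_var 0" by (simp_all add: q)
      then show ?thesis using I that by simp
    qed
    ultimately show "?I (Suc v) (put (sem ?p r) v_var 0 (Suc v))"
      unfolding q_def[symmetric] by blast
  qed (use ok in \<open>simp_all add: input_ok_def\<close>)
  then show "\<forall>v<n. table s v v 0 \<le> s' order_var 0"
    and "s' order_var 0 \<noteq> 0 \<Longrightarrow>
      s' root_var 0 < n \<and> table s (s' root_var 0) (s' root_var 0) 0 = s' order_var 0"
    by (simp_all add: s'_def find_root_def)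
qed

lemma expand_correct:
  assumes ok: "input_ok s" and v: "s v_var 0 = v" "v < n" and k: "s round_var 0 = k"
    and p: "s parent_arr v = p" and l: "s class_arr v = l" and i: "s parent_class_arr v = i"
    and feas: "feasible v p l i"
    and tab: "\<forall>v<n. \<forall>p<n. \<forall>i<n. table_ok (table s) v p i"
  defines "s' \<equiv> sem expand s"
  shows "u \<notin> others v p \<Longrightarrow> s' class_arr u = s class_arr u \<and> s' level_arr u = s level_arr u \<and>
      s' parent_arr u = s parent_arr u \<and> s' parent_class_arr u = s parent_class_arr u"
    and "u \<in> others v p \<Longrightarrow> s' level_arr u = k + 2 \<and> s' parent_arr u = v \<and>
      s' parent_class_arr u = l \<and> feasible u v (s' class_arr u) l"
    and "{1..l} \<subseteq> insert i (s' class_arr ` others v p)"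
proof -
  let ?b = "When (Cell 1 (index2 (Var v_var) (Var u_var)))
        (When (neq (Var u_var) (Var p_var)) set_child)"
  define s1 where "s1 = put (put (put s p_var 0 p) l_var 0 l) i_var 0 i"
  define s2 where "s2 = sem greedy s1"
  have s': "s' = sem (For u_var ?b) s2"
    using v p l i by (simp add: s'_def expand_def s2_def s1_def)
  have s1: "s1 0 = s 0" "s1 1 = s 1" "s1 row_arr = s row_arr" "s1 tab_arr = s tab_arr"
    "s1 v_var 0 = v" "s1 p_var 0 = p" "s1 l_var 0 = l" "s1 i_var 0 = i"
    using v by (simp_all add: s1_def)
  have ok1: "input_ok s1" using ok input_ok_cong s1 by blast
  have ln: "1 \<le> l" "l < n" using feas feasible_iff[of v p l i] by blast+
  have oth: "u < n" if "u \<in> others v p" for u using that E_less by (auto simp: others_def)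
  have tab1: "\<forall>u\<in>others v p. table_ok (table s1) u v l"
    using tab oth v(2) ln(2) table_cong[of s1 s, OF s1(4)] by simp
  note greedy = greedy_correct[OF ok1 s1(5) v(2) s1(6,7) ln s1(8) tab1, folded s2_def]
  have s2: "s2 0 = s 0" "s2 1 = s 1" "s2 row_arr = s row_arr"
    "s2 v_var 0 = v" "s2 p_var 0 = p" "s2 l_var 0 = l" "s2 round_var 0 = k"
    "s2 class_arr = s class_arr" "s2 level_arr = s level_arr" "s2 parent_arr = s parent_arr"
    "s2 parent_class_arr = s parent_class_arr"
    using s1 k by (simp_all add: s2_def sem_frame) (simp_all add: s1_def)
  let ?g = "\<lambda>u. max 1 (s2 asg_arr u)"
  let ?I = "\<lambda>j r.
      (\<forall>u. r class_arr u = (if u < j \<and> u \<in> others v p then ?g u else s class_arr u)) \<and>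
      (\<forall>u. r level_arr u = (if u < j \<and> u \<in> others v p then k + 2 else s level_arr u)) \<and>
      (\<forall>u. r parent_arr u = (if u < j \<and> u \<in> others v p then v else s parent_arr u)) \<and>
      (\<forall>u. r parent_class_arr u =
        (if u < j \<and> u \<in> others v p then l else s parent_class_arr u))"
  have I: "?I n s'"
    unfolding s'
  proof (rule For_invariant[where I = ?I and s = s2])
    show "s2 0 0 = n" using ok by (simp add: s2 input_ok_def)
    show "?I 0 (put s2 u_var 0 0)" by (simp add: s2)
  next
    fix j r
    assume j: "j < n" "r u_var 0 = j" and I: "?I j r"
      and fr: "\<And>y. y \<notin> insert u_var (writes ?b) \<Longrightarrow> r y = s2 y"
    have r: "r 0 = s 0" "r 1 = s 1" "r row_arr = s row_arr" "r v_var 0 = v" "r p_var 0 = p"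
        "r l_var 0 = l" "r round_var 0 = k" "r asg_arr = s2 asg_arr"
      using s2 by (simp_all add: fr)
    have rok: "input_ok r" using ok input_ok_cong r by blast
    have ix: "aval (index2 (Var v_var) (Var u_var)) r = v * n + j"
      using aval_index2[OF rok] r(4) v(2) j by simp
    have adj: "s 1 (v * n + j) \<noteq> 0 \<longleftrightarrow> E v j" using ok v(2) j(1) by (simp add: input_ok_def)
    have sem: "sem ?b r = (if j \<in> others v p then sem set_child r else r)"
      using adj r(2,5) j(2) by (simp add: ix others_def)
    define q where "q = put (sem ?b r) u_var 0 (Suc j)"
    have "\<forall>u. q class_arr u = (if u = j \<and> u \<in> others v p then ?g u else r class_arr u)"
      "\<forall>u. q level_arr u = (if u = j \<and> u \<in> others v p then k + 2 else r level_arr u)"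
      "\<forall>u. q parent_arr u = (if u = j \<and> u \<in> others v p then v else r parent_arr u)"
      "\<forall>u. q parent_class_arr u = (if u = j \<and> u \<in> others v p then l else r parent_class_arr u)"
      using r j(2) unfolding q_def sem by (auto simp: set_child_def max_def)
    then show "?I (Suc j) (put (sem ?b r) u_var 0 (Suc j))"
      using I unfolding q_def[symmetric] by (simp add: less_Suc_eq)
  qed simp
  show "u \<notin> others v p \<Longrightarrow> s' class_arr u = s class_arr u \<and> s' level_arr u = s level_arr u \<and>
      s' parent_arr u = s parent_arr u \<and> s' parent_class_arr u = s parent_class_arr u"
    using I by simp
  show "u \<in> others v p \<Longrightarrow> s' level_arr u = k + 2 \<and> s' parent_arr u = v \<and>
      s' parent_class_arr u = l \<and> feasible u v (s' class_arr u) l"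
    using I oth[of u] greedy(2)[OF feas] by simp
  have "s' class_arr ` others v p = ?g ` others v p"
    using I oth by (intro image_cong) simp_all
  then show "{1..l} \<subseteq> insert i (s' class_arr ` others v p)" using greedy(3)[OF feas] by simp
qed

section \<open>Spreading labels from the root\<close>

lemma parent_exists:
  assumes R: "R < n"
  shows "\<exists>pa. pa R = R \<and> (\<forall>v<n. v \<noteq> R \<longrightarrow> E v (pa v) \<and> d R v = Suc (d R (pa v)))"
proof (intro exI[of _ "\<lambda>v. if v = R then R else SOME u. E v u \<and> d R v = Suc (d R u)"]
    conjI allI impI)
  fix v assume v: "v < n" "v \<noteq> R"
  let ?u = "SOME u. E v u \<and> d R v = Suc (d R u)"
  have "E v ?u \<and> d R v = Suc (d R ?u)" by (rule someI_ex[OF closer_ex[OF R v]])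
  then show "E v (if v = R then R else ?u)" "d R v = Suc (d R (if v = R then R else ?u))"
    using v(2) by simp_all
qed simp

lemma spread_correct:
  assumes ok: "input_ok s" and tab: "\<forall>v<n. \<forall>p<n. \<forall>i<n. table_ok (table s) v p i"
    and R: "R < n" and feas: "feasible R R (s class_arr R) 0"
    and root: "s level_arr R = 1" "s parent_arr R = R" "s parent_class_arr R = 0"
    and fresh: "\<forall>v<n. v \<noteq> R \<longrightarrow> s level_arr v = 0"
  shows "total_labelling (sem spread s class_arr)" "sem spread s class_arr R = s class_arr R"
proof -
  obtain pa where paR: "pa R = R"
    and pa: "\<And>v. v < n \<Longrightarrow> v \<noteq> R \<Longrightarrow> E v (pa v) \<and> d R v = Suc (d R (pa v))"
    using parent_exists[OF R] by blast
  define D where "D = d R"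
  have DR: "D v = 0 \<longleftrightarrow> v = R" if "v < n" for v using d_zero[OF R that] by (auto simp: D_def)
  have pa_n: "pa v < n" if "v < n" for v
    using that pa[OF that] paR E_less by (cases "v = R") auto
  have D_pa: "D (pa v) \<le> D v" if "v < n" for v
    using that pa[OF that] paR by (cases "v = R") (auto simp: D_def)
  \<comment> \<open>For the tree rooted at \<open>R\<close>, the neighbours other than the parent
    are the children. At \<open>R\<close> itself, \<open>pa R = R\<close> removes no
    neighbour.\<close>
  have child: "u \<in> others v (pa v) \<longleftrightarrow> E v u \<and> D u = Suc (D v)" if v: "v < n" for u v
  proof
    assume u: "u \<in> others v (pa v)"
    then have E: "E v u" "u \<noteq> pa v" by (auto simp: others_def)
    have "D v \<noteq> Suc (D u)"
    proof
      assume Dv: "D v = Suc (D u)"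
      then have "v \<noteq> R" using DR[OF v] by auto
      have "u = pa v"
        by (rule closer_unique[OF R E(1)])
          (use pa[OF v \<open>v \<noteq> R\<close>] Dv in \<open>simp_all only: D_def\<close>)
      then show False using E by simp
    qed
    then show "E v u \<and> D u = Suc (D v)" using d_step[OF R E(1)] E by (auto simp: D_def)
  next
    assume "E v u \<and> D u = Suc (D v)"
    then show "u \<in> others v (pa v)" using D_pa[OF v] by (auto simp: others_def)
  qed
  have pa_child: "pa u = v" if "E v u" "D u = Suc (D v)" for u v
  proof -
    have u: "u < n" "u \<noteq> R" using that E_less DR[of u] by auto
    show ?thesis
      by (rule closer_unique[OF R _ E_sym[OF that(1)]])
        (use pa[OF u] that(2) in \<open>simp_all only: D_def\<close>)
  qed
  define good where "good w r \<longleftrightarrow> r level_arr w = Suc (D w) \<and> r parent_arr w = pa w \<and>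
      r parent_class_arr w = (if w = R then 0 else r class_arr (pa w)) \<and>
      feasible w (pa w) (r class_arr w) (r parent_class_arr w)" for w and r :: state
  define sat where "sat w r \<longleftrightarrow> (\<forall>j\<in>{1..r class_arr w}. \<exists>u. E w u \<and> r class_arr u = j)"
    for w and r :: state
  \<comment> \<open>After \<open>k\<close> rounds the vertices down to depth \<open>k\<close> are
    labelled, but those at depth \<open>k\<close> still lack labelled children, hence the strict
    bound for \<open>sat\<close>.\<close>
  define Inv where "Inv k r \<longleftrightarrow> r class_arr R = s class_arr R \<and>
      (\<forall>w<n. D w \<le> k \<longrightarrow> good w r) \<and> (\<forall>w<n. k < D w \<longrightarrow> r level_arr w = 0) \<and>
      (\<forall>w<n. D w < k \<longrightarrow> sat w r)" for k and r :: state
  have good_cong: "good w r \<longleftrightarrow> good w q"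
    if "\<And>x. x \<in> {w, pa w} \<Longrightarrow> r class_arr x = q class_arr x" "r level_arr w = q level_arr w"
      "r parent_arr w = q parent_arr w" "r parent_class_arr w = q parent_class_arr w" for w r q
    using that by (simp add: good_def)
  have sat_cong: "sat w r \<longleftrightarrow> sat w q"
    if "\<And>x. x = w \<or> E w x \<Longrightarrow> r class_arr x = q class_arr x" for w r q
  proof -
    have "E w u \<and> r class_arr u = j \<longleftrightarrow> E w u \<and> q class_arr u = j" for u j using that[of u] by auto
    then show ?thesis using that[of w] by (simp add: sat_def)
  qed
  let ?b = "When (is_zero (neq (Cell level_arr (Var v_var)) (Plus (Var round_var) (N 1)))) expand"
  have round: "Inv (Suc k) (sem (For v_var ?b) t)"
    if Inv: "Inv k t" and tok: "input_ok t" and tk: "t round_var 0 = k"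
      and ttab: "\<forall>v<n. \<forall>p<n. \<forall>i<n. table_ok (table t) v p i" for k t
  proof -
    \<comment> \<open>During a round the layer at depth \<open>Suc k\<close> is only partly
      labelled, so both level values are allowed there.\<close>
    define J where "J r \<longleftrightarrow> r class_arr R = s class_arr R \<and> (\<forall>w<n. D w \<le> k \<longrightarrow> good w r) \<and>
        (\<forall>w<n. D w = Suc k \<longrightarrow> r level_arr w = 0 \<or> r level_arr w = Suc (Suc k)) \<and>
        (\<forall>w<n. Suc k < D w \<longrightarrow> r level_arr w = 0) \<and>
        (\<forall>w<n. D w < k \<longrightarrow> sat w r)" for r
    define Q where "Q v r \<longleftrightarrow> (D v = k \<longrightarrow> sat v r \<and> (\<forall>u\<in>others v (pa v). good u r))" for v r
    have put: "good w (put r v_var a b) = good w r" "sat w (put r v_var a b) = sat w r"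
      "J (put r v_var a b) = J r" "Q w (put r v_var a b) = Q w r" for w r a b
      by (simp_all add: good_def sat_def J_def Q_def)
    have "J (sem (For v_var ?b) t) \<and> (\<forall>v<n. Q v (sem (For v_var ?b) t))"
    proof (rule For_each[where J = J and Q = Q and s = t])
      show "t 0 0 = n" using tok by (simp add: input_ok_def)
      have "J t" using Inv by (simp add: J_def Inv_def)
      then show "J (put t v_var 0 0)" by (simp add: put)
    next
      fix v r
      assume v: "v < n" and rv: "r v_var 0 = v" and J: "J r"
        and fr: "\<And>y. y \<notin> insert v_var (writes ?b) \<Longrightarrow> r y = t y"
      have r: "r 0 = t 0" "r 1 = t 1" "r row_arr = t row_arr" "r tab_arr = t tab_arr"
          "r round_var 0 = k"
        using tk by (simp_all add: fr)
      have rok: "input_ok r" using tok input_ok_cong r by blast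
      have rtab: "\<forall>v<n. \<forall>p<n. \<forall>i<n. table_ok (table r) v p i"
        using ttab table_cong[of r t, OF r(4)] by simp
      \<comment> \<open>Children labelled earlier in this round carry level
        \<open>Suc (Suc k)\<close>, so they are not expanded prematurely.\<close>
      have level: "r level_arr v = Suc k \<longleftrightarrow> D v = k"
      proof (cases "D v \<le> k")
        case True
        then show ?thesis using J v by (simp add: J_def good_def)
      next
        case False
        then consider "D v = Suc k" | "Suc k < D v" by linarith
        then show ?thesis using J v False by cases (auto simp: J_def)
      qed
      define q where "q = sem ?b r"
      have q: "q = (if D v = k then sem expand r else r)"
        using level rv r(5) by (simp add: q_def)
      have "J q \<and> Q v q \<and> (\<forall>j<v. Q j r \<longrightarrow> Q j q)"
      proof (cases "D v = k")
        case False
        then show ?thesis using J q by (simp add: Q_def)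
      next
        case True
        then have qe: "q = sem expand r" using q by simp
        have gv: "good v r" using J v True by (simp add: J_def)
        have pv: "r parent_arr v = pa v" "feasible v (pa v) (r class_arr v) (r parent_class_arr v)"
          "r parent_class_arr v = (if v = R then 0 else r class_arr (pa v))"
          using gv unfolding good_def by blast+
        note ex = expand_correct[OF rok rv v r(5) pv(1) refl refl pv(2) rtab, folded qe]
        have same: "q class_arr u = r class_arr u" "q level_arr u = r level_arr u"
            "q parent_arr u = r parent_arr u" "q parent_class_arr u = r parent_class_arr u"
          if "D u \<noteq> Suc k \<or> \<not> E v u" for u
          using ex(1)[of u] child[OF v, of u] that True by auto
        have goodsame: "good w q" if "w < n" "D w \<le> k" for w
        proof -
          have "good w q \<longleftrightarrow> good w r"
            by (rule good_cong) (use same that D_pa[of w] in auto)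
          then show ?thesis using J that by (simp add: J_def)
        qed
        have "sat w q" if "w < n" "D w < k" for w
        proof -
          have "D x \<noteq> Suc k" if "x = w \<or> E w x" for x
            using that \<open>D w < k\<close> d_step[OF R, of w x] by (auto simp: D_def)
          then have "sat w q \<longleftrightarrow> sat w r" by (intro sat_cong same(1)) blast
          then show ?thesis using J that by (simp add: J_def)
        qed
        moreover have "q level_arr w = 0 \<or> q level_arr w = Suc (Suc k)"
          if "w < n" "D w = Suc k" for w
          using ex(1,2)[of w] J that by (cases "w \<in> others v (pa v)") (auto simp: J_def)
        moreover have "q level_arr w = 0" if "w < n" "Suc k < D w" for w
          using same(2)[of w] J that by (simp add: J_def)
        moreover have "q class_arr R = s class_arr R"
          using same(1)[of R] DR[OF R] J by (simp add: J_def)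
        ultimately have Jq: "J q" using goodsame by (simp add: J_def)
        have vsame: "q class_arr v = r class_arr v" using same(1)[of v] True by simp
        have "good u q" if u: "u \<in> others v (pa v)" for u
        proof -
          have E: "E v u" "D u = Suc (D v)" using u child[OF v] by auto
          have "pa u = v" using pa_child E by blast
          moreover have "u \<noteq> R" using E DR[OF R] by auto
          ultimately show ?thesis using ex(2)[OF u] vsame E True by (simp add: good_def)
        qed
        moreover have "sat v q"
          unfolding sat_def
        proof
          fix j assume j: "j \<in> {1..q class_arr v}"
          then have "j \<in> insert (r parent_class_arr v) (q class_arr ` others v (pa v))"
            using ex(3) vsame by auto
          then show "\<exists>u. E v u \<and> q class_arr u = j"
          proof
            \<comment> \<open>As \<open>j\<close> is positive and the root has parent class 0, this
              label comes from a genuine parent, whose class the current pass leaves alone.\<close>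
            assume jp: "j = r parent_class_arr v"
            then have "v \<noteq> R" using j pv(3) by auto
            then have "E v (pa v)" "r class_arr (pa v) = j" using pa[OF v] pv(3) jp by auto
            moreover have "q class_arr (pa v) = r class_arr (pa v)"
              using same(1)[of "pa v"] D_pa[OF v] True by simp
            ultimately show ?thesis by auto
          next
            assume "j \<in> q class_arr ` others v (pa v)"
            then show ?thesis by (auto simp: others_def)
          qed
        qed
        ultimately have Qv: "Q v q" by (simp add: Q_def)
        have "Q j q" if j: "j < v" and Qj: "Q j r" for j
          unfolding Q_def
        proof
          assume Dj: "D j = k"
          have jn: "j < n" using j v by simp
          \<comment> \<open>Parents are unique: a neighbour of \<open>j\<close> at depth
            \<open>Suc k\<close> is a child of \<open>j\<close> and hence not of \<open>v\<close>,
            so expanding \<open>v\<close> changes nothing around \<open>j\<close>.\<close>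
          have nb: "D u \<noteq> Suc k \<or> \<not> E v u" if "u = j \<or> E j u" for u
            using that Dj True pa_child[of v u] pa_child[of j u] j by auto
          have "sat j q \<longleftrightarrow> sat j r" by (intro sat_cong same(1) nb)
          moreover have "good u q \<longleftrightarrow> good u r" if u: "u \<in> others j (pa j)" for u
          proof -
            have E: "E j u" "D u = Suc (D j)" using u child[OF jn] by auto
            have "pa u = j" using pa_child E by blast
            then show ?thesis using nb E by (intro good_cong same) auto
          qed
          ultimately show "sat j q \<and> (\<forall>u\<in>others j (pa j). good u q)"
            using Qj Dj by (simp add: Q_def)
        qed
        then show ?thesis using Jq Qv by blast
      qed
      then show "J (put (sem ?b r) v_var 0 (Suc v)) \<and> Q v (put (sem ?b r) v_var 0 (Suc v)) \<and>
          (\<forall>j<v. Q j r \<longrightarrow> Q j (put (sem ?b r) v_var 0 (Suc v)))"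
        unfolding put q_def .
    qed simp
    then have J: "J (sem (For v_var ?b) t)" and Q: "\<And>v. v < n \<Longrightarrow> Q v (sem (For v_var ?b) t)"
      by blast+
    have "good w (sem (For v_var ?b) t)" if w: "w < n" "D w = Suc k" for w
    proof -
      have "w \<noteq> R" using w DR[of w] by auto
      then have E: "E w (pa w)" "D w = Suc (D (pa w))" using pa w by (simp_all add: D_def)
      \<comment> \<open>Each vertex of the new layer was labelled when its parent was expanded, so
        \<open>Q\<close> at the parent applies.\<close>
      then have "w \<in> others (pa w) (pa (pa w))" using child[OF pa_n[OF w(1)]] E_sym by blast
      then show ?thesis using Q[OF pa_n[OF w(1)]] E w by (simp add: Q_def)
    qed
    moreover have "sat w (sem (For v_var ?b) t)" if "w < n" "D w = k" for w
      using Q that by (simp add: Q_def)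
    ultimately show ?thesis using J unfolding Inv_def J_def by (metis le_Suc_eq less_Suc_eq)
  qed
  have putInv: "Inv k (put r round_var a b) = Inv k r" for k r a b
    by (simp add: Inv_def good_def sat_def)
  have "Inv n (sem spread s)"
    unfolding spread_def
  proof (rule For_invariant[where I = Inv and s = s])
    show "s 0 0 = n" using ok by (simp add: input_ok_def)
    have "good R s" using root feas paR DR[OF R] by (simp add: good_def)
    moreover have "s level_arr w = 0" if "w < n" "0 < D w" for w using that DR[of w] fresh by auto
    ultimately have "Inv 0 s" using DR by (auto simp: Inv_def)
    then show "Inv 0 (put s round_var 0 0)" by (simp add: putInv)
  next
    fix k r
    assume rk: "r round_var 0 = k" and Inv: "Inv k r"
      and fr: "\<And>y. y \<notin> insert round_var (writes (For v_var ?b)) \<Longrightarrow> r y = s y"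
    have r: "r 0 = s 0" "r 1 = s 1" "r row_arr = s row_arr" "r tab_arr = s tab_arr"
      by (simp_all add: fr)
    have "input_ok r" using ok input_ok_cong r by blast
    then show "Inv (Suc k) (put (sem (For v_var ?b) r) round_var 0 (Suc k))"
      unfolding putInv using round[OF Inv _ rk] tab table_cong[of r s, OF r(4)] by simp
  qed simp
  \<comment> \<open>Depths stay below \<open>n\<close>, so after \<open>n\<close> rounds even the
    strict clause of \<open>Inv\<close> covers every vertex.\<close>
  moreover have "D w < n" if "w < n" for w using d_less[OF R that] by (simp add: D_def)
  ultimately have fin: "good w (sem spread s)" "sat w (sem spread s)" if "w < n" for w
    using that by (simp_all add: Inv_def order_less_imp_le)
  show "sem spread s class_arr R = s class_arr R" using \<open>Inv n _\<close> by (simp add: Inv_def)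
  show "total_labelling (sem spread s class_arr)"
    unfolding total_labelling_def
  proof (intro allI impI conjI)
    fix v assume "v < n"
    show "1 \<le> sem spread s class_arr v"
      using fin(1)[OF \<open>v < n\<close>] unfolding good_def feasible_iff[of v] by blast
    show "\<forall>j\<in>{1..sem spread s class_arr v}. \<exists>u. E v u \<and> sem spread s class_arr u = j"
      using fin(2)[OF \<open>v < n\<close>] by (simp add: sat_def)
  qed
qed

lemma solve_correct:
  assumes "2 \<le> n" and n: "s 0 0 = n" and adj: "\<forall>u<n. \<forall>v<n. s 1 (u * n + v) \<noteq> 0 \<longleftrightarrow> E u v"
    and fresh: "\<forall>v<n. s level_arr v = 0"
  defines "s' \<equiv> sem solve s"
  shows "total_labelling (s' class_arr)"
    and "\<exists>v<n. s' class_arr v = s' order_var 0"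
    and "\<And>f v. total_labelling f \<Longrightarrow> v < n \<Longrightarrow> f v \<le> s' order_var 0"
proof -
  define s1 where "s1 = sem fill_rows s"
  define s2 where "s2 = sem fill_table s1"
  define s3 where "s3 = sem find_root s2"
  define s4 where "s4 = sem init_root s3"
  have s': "s' = sem spread s4" by (simp add: s'_def s1_def s2_def s3_def s4_def solve_def)
  have "s1 0 = s 0" "s1 1 = s 1" "s1 level_arr = s level_arr" by (simp_all add: s1_def sem_frame)
  then have ok1: "input_ok s1" and fresh1: "\<forall>v<n. s1 level_arr v = 0"
    using fill_rows_correct[of s, OF n] n adj fresh by (simp_all add: input_ok_def s1_def)
  have s2: "s2 0 = s1 0" "s2 1 = s1 1" "s2 row_arr = s1 row_arr" "s2 level_arr = s1 level_arr"
    by (simp_all add: s2_def sem_frame)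
  have ok2: "input_ok s2" using ok1 input_ok_cong s2 by blast
  have tab2: "\<forall>v<n. \<forall>p<n. \<forall>i<n. table_ok (table s2) v p i"
    unfolding s2_def by (rule fill_table_correct[OF ok1])
  define K where "K = s3 order_var 0"
  define R where "R = s3 root_var 0"
  have K: "\<forall>v<n. table s2 v v 0 \<le> K" "K \<noteq> 0 \<Longrightarrow> R < n \<and> table s2 R R 0 = K"
    using find_root_correct[OF ok2] by (simp_all add: K_def R_def s3_def)
  \<comment> \<open>Optimality: any total labelling makes \<open>f v\<close> feasible with
    \<open>v\<close> as root, so it is bounded by that table entry and hence by the best
    one.\<close>
  have upper: "f v \<le> K" if "total_labelling f" "v < n" for f v
  proof -
    have "feasible v v (f v) 0" using total_labelling_feasible[OF that, of v] E_irrefl by simp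
    then have "f v \<le> table s2 v v 0" using tab2 that(2) by (auto simp: table_ok_def)
    then show ?thesis using K(1) that(2) le_trans by blast
  qed
  \<comment> \<open>With two vertices every \<open>v\<close> has a neighbour, found by descending
    towards some other vertex \<open>r\<close>. The constant labelling then forces
    \<open>K \<noteq> 0\<close>, the condition under which \<open>root_var\<close> is
    meaningful.\<close>
  have "total_labelling (\<lambda>_. 1)"
    unfolding total_labelling_def
  proof (intro allI impI conjI)
    fix v assume v: "v < n"
    define r where "r = (if v = 0 then 1 else 0 :: nat)"
    have "r < n" "v \<noteq> r" using \<open>2 \<le> n\<close> by (auto simp: r_def)
    then obtain u where "E v u" using closer_ex[of r v] v by blast
    then show "\<forall>j\<in>{1..1::nat}. \<exists>u. E v u \<and> 1 = j" by auto
  qed simp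
  then have "K \<noteq> 0" using upper[of "\<lambda>_. 1" 0] \<open>2 \<le> n\<close> by simp
  then have R: "R < n" "table s2 R R 0 = K" using K(2) by blast+
  have feas: "feasible R R K 0" using tab2 R \<open>K \<noteq> 0\<close> by (auto simp: table_ok_def)
  have s3: "s3 0 = s2 0" "s3 1 = s2 1" "s3 row_arr = s2 row_arr" "s3 tab_arr = s2 tab_arr"
      "s3 level_arr = s1 level_arr"
    using s2 by (simp_all add: s3_def sem_frame)
  have s4: "s4 0 = s2 0" "s4 1 = s2 1" "s4 row_arr = s2 row_arr" "s4 tab_arr = s2 tab_arr"
      "s4 order_var = s3 order_var"
    using s3 by (simp_all add: s4_def sem_frame)
  have root: "s4 class_arr R = K" "s4 level_arr R = 1" "s4 parent_arr R = R"
      "s4 parent_class_arr R = 0" "\<forall>v<n. v \<noteq> R \<longrightarrow> s4 level_arr v = 0"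
    using fresh1 by (simp_all add: s4_def init_root_def K_def R_def s3(5))
  have ok4: "input_ok s4" using ok2 input_ok_cong s4 by blast
  have tab4: "\<forall>v<n. \<forall>p<n. \<forall>i<n. table_ok (table s4) v p i"
    using tab2 table_cong[of s4 s2, OF s4(4)] by simp
  note spread = spread_correct[OF ok4 tab4 R(1) _ root(2-5), unfolded root(1), OF feas, folded s']
  have order: "s' order_var 0 = K" using s4(5) by (simp add: s' sem_frame K_def)
  show "total_labelling (s' class_arr)" by (rule spread(1))
  show "\<exists>v<n. s' class_arr v = s' order_var 0" using spread(2) R(1) order by auto
  show "f v \<le> s' order_var 0" if "total_labelling f" "v < n" for f v
    using upper[OF that] order by simp
qed

end

section \<open>Labellings and partitions\<close>

locale tree_graph =
  fixes T :: "nat pair_pre_digraph" and n :: nat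
  assumes tree: "undirected_tree T" and verts: "pverts T = {0..<n}"
begin

sublocale tree_dist n "\<lambda>u v. (u, v) \<in> parcs T" "graph_dist (parcs T)"
  by (rule tree_dist_of_undirected_tree[OF tree verts])

text \<open>No class is empty because a vertex labelled \<open>k\<close> sees every smaller label,
  and \<open>k\<close> itself.\<close>

lemma partition_of_labelling:
  assumes f: "total_labelling f" and max: "\<And>v. v < n \<Longrightarrow> f v \<le> k" and k: "\<exists>v<n. f v = k"
  shows "total_transitive_partition T k (\<lambda>i. {v \<in> pverts T. f v = i})"
proof -
  let ?V = "\<lambda>i. {v \<in> pverts T. f v = i}"
  have ge: "1 \<le> f v" if "v < n" for v using f that by (simp add: total_labelling_def)
  have nb: "\<exists>u. (v, u) \<in> parcs T \<and> u < n \<and> f u = j" if "v < n" "1 \<le> j" "j \<le> f v" for v j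
    using total_labelling_neighbour[OF f that(1), of j] that E_less by auto
  have ne: "?V i \<noteq> {}" if "i \<in> {1..k}" for i
  proof -
    obtain v where "v < n" "f v = k" using k by blast
    then obtain u where "u < n" "f u = i" using nb[of v i] \<open>i \<in> {1..k}\<close> by auto
    then show ?thesis using verts by auto
  qed
  have "partition_on (pverts T) (?V ` {1..k})"
    unfolding partition_on_def
  proof (intro conjI)
    show "\<Union> (?V ` {1..k}) = pverts T" using ge max verts by auto
    show "disjoint (?V ` {1..k})" by (auto simp: disjoint_def)
    show "{} \<notin> ?V ` {1..k}" using ne by blast
  qed
  moreover have "inj_on ?V {1..k}" using ne by (fastforce simp: inj_on_def)
  moreover have "\<exists>u\<in>?V i. (v, u) \<in> parcs T" if "1 \<le> i" "i \<le> j" "v \<in> ?V j" for i j v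
    using nb[of v i] that verts by auto
  ultimately show ?thesis unfolding total_transitive_partition_def by blast
qed

text \<open>The labelling is the class number. Disjointness concerns the set of classes, so the
  number is unique only together with \<open>inj_on\<close>.\<close>

lemma labelling_of_partition:
  assumes V: "total_transitive_partition T k V" and k: "1 \<le> k"
  shows "\<exists>f. total_labelling f \<and> (\<exists>v<n. f v = k)"
proof -
  have part: "partition_on {0..<n} (V ` {1..k})" and inj: "inj_on V {1..k}"
    and nb: "\<And>i j v. 1 \<le> i \<Longrightarrow> i \<le> j \<Longrightarrow> j \<le> k \<Longrightarrow> v \<in> V j \<Longrightarrow> \<exists>u\<in>V i. (v, u) \<in> parcs T"
    using V verts by (auto simp: total_transitive_partition_def)
  have un: "(\<Union>i\<in>{1..k}. V i) = {0..<n}" using part by (simp add: partition_on_def)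
  have uniq: "i = j" if "v \<in> V i" "v \<in> V j" "i \<in> {1..k}" "j \<in> {1..k}" for v i j
  proof -
    have "V i = V j"
      using partition_onD2[OF part] that unfolding disjoint_def by blast
    then show ?thesis using inj that by (auto dest: inj_onD)
  qed
  have "\<forall>v\<in>{0..<n}. \<exists>i. i \<in> {1..k} \<and> v \<in> V i" using un by blast
  then obtain f where f: "\<And>v. v < n \<Longrightarrow> f v \<in> {1..k} \<and> v \<in> V (f v)" by (metis atLeastLessThan_iff zero_le)
  have eq: "f v = i" if "v \<in> V i" "i \<in> {1..k}" for v i
  proof -
    have "v < n" using un that by auto
    then show ?thesis using uniq[of v "f v" i] f that by blast
  qed
  have "total_labelling f"
    unfolding total_labelling_def
  proof (intro allI impI conjI ballI)
    fix v assume v: "v < n"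
    show "1 \<le> f v" using f[OF v] by simp
    fix j assume "j \<in> {1..f v}"
    then have j: "1 \<le> j" "j \<le> f v" "f v \<le> k" using f[OF v] by auto
    obtain u where "u \<in> V j" "(v, u) \<in> parcs T" using nb[OF j] f[OF v] by blast
    then show "\<exists>u. (v, u) \<in> parcs T \<and> f u = j" using eq[of u j] j by auto
  qed
  moreover have "V k \<noteq> {}" using partition_onD3[OF part] k by auto
  then obtain v where "v \<in> V k" by blast
  then have "v < n" "f v = k" using un eq[of v k] k by auto
  ultimately show ?thesis by blast
qed

text \<open>Through \<open>labelling_of_partition\<close> the bound on labels bounds every order, so
  the set under \<open>Max\<close> is finite with largest element \<open>k\<close>.\<close>

lemma Tr_t_eq:
  assumes "total_transitive_partition T k V"
    and "\<And>f v. total_labelling f \<Longrightarrow> v < n \<Longrightarrow> f v \<le> k"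
  shows "Tr_t T = k"
proof -
  have le: "k' \<le> k" if V: "total_transitive_partition T k' V'" for k' V'
    using labelling_of_partition[OF V] assms(2) by (cases "k' = 0") force+
  show ?thesis
    unfolding Tr_t_def
  proof (rule Max_eqI)
    show "finite {k. \<exists>V. total_transitive_partition T k V}"
      by (rule finite_subset[of _ "{..k}"]) (use le in auto)
  qed (use assms(1) le in auto)
qed

lemma exec_solve:
  assumes "2 \<le> n"
  shows "\<exists>t s. exec (compile solve) (input_state T) t s \<and> t \<le> poly (cost solve) n \<and>
    total_transitive_partition T (output_order s) (output_class T s) \<and> output_order s = Tr_t T"
proof -
  let ?s = "input_state T"
  define s' where "s' = sem solve ?s"
  have card: "card (pverts T) = n" using verts by simp
  have n: "?s 0 0 = n" by (simp add: input_state_def card)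
  have adj: "\<forall>u<n. \<forall>v<n. ?s 1 (u * n + v) \<noteq> 0 \<longleftrightarrow> (u, v) \<in> parcs T"
    using index_less by (simp add: input_state_def card)
  have fresh: "\<forall>v<n. ?s level_arr v = 0" by (simp add: input_state_def)
  note solve = solve_correct[OF assms n adj fresh, folded s'_def]
  have part: "total_transitive_partition T (s' order_var 0) (\<lambda>i. {v \<in> pverts T. s' class_arr v = i})"
    by (rule partition_of_labelling[OF solve(1)]) (use solve in auto)
  have class_eq: "output_class T s' = (\<lambda>i. {v \<in> pverts T. s' class_arr v = i})"
    by (simp add: output_class_def fun_eq_iff)
  have "output_order s' = Tr_t T"
    unfolding output_order_def by (rule Tr_t_eq[OF part, symmetric]) (rule solve(3))
  moreover have "total_transitive_partition T (output_order s') (output_class T s')"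
    using part unfolding class_eq output_order_def .
  moreover obtain t where "exec (compile solve) ?s t s'" "t \<le> poly (cost solve) n"
    using exec_compile[OF wf_solve(6), of ?s] n by (auto simp: s'_def)
  ultimately show ?thesis by blast
qed

end

theorem theorem6:
  shows "\<exists>(c :: com) (p :: nat poly). \<forall>(T :: nat pair_pre_digraph) n.
    undirected_tree T \<and> pverts T = {0..<n} \<and> 2 \<le> n \<longrightarrow>
    (\<exists>t s. exec c (input_state T) t s \<and> t \<le> poly p n \<and>
       total_transitive_partition T (output_order s) (output_class T s) \<and>
       output_order s = Tr_t T)"
proof (rule exI[of _ "compile solve"], rule exI[of _ "cost solve"], intro allI impI)
  fix T :: "nat pair_pre_digraph" and n
  assume T: "undirected_tree T \<and> pverts T = {0..<n} \<and> 2 \<le> n"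
  then interpret tree_graph T n by unfold_locales auto
  show "\<exists>t s. exec (compile solve) (input_state T) t s \<and> t \<le> poly (cost solve) n \<and>
      total_transitive_partition T (output_order s) (output_class T s) \<and> output_order s = Tr_t T"
    using exec_solve T by blast
qed

end
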